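(* Let $1\le s\le q<\infty$, $w\in\mathcal A_{q/s}$, and let $\mathcal T:L^q_{\mathrm{loc}}(w)\to L^q_{\mathrm{loc}}(w)$ be a sublinear operator with the following property: there is a constant $C_0>0$ such that for all balls $B\subset\mathbb R^n$ and all $f\in L^q_{\mathrm{loc}}(w)$, $$|\mathcal T(f\chi_{(2B)^c})(x)|\le C_0\sum_{k=1}^\infty k\left(\frac1{|2^{k+1}B|}\int_{2^{k+1}B}|f(z)|^s\,dz\right)^{1/s}\quad\text{for a.e. }x\in B.$$ Then: (1) If $q>1$ and $\mathcal T$ is bounded on $L^q(w)$, then $\mathcal T$ is also bounded on $(L^q(w),L^p)^\alpha$ for $q\le\alpha<p\le\infty$; i.e. there is $C>0$ with $\|\mathcal Tf\|_{(L^q(w),L^p)^\alpha}\le C\|f\|_{(L^q(w),L^p)^\alpha}$ for all $f\in (L^q(w),L^p)^\alpha$. (2) If $q=1$ and there is a constant $C_1>0$ such that for all $\lambda>0$ and all $f\in L^1(w)$ $$w(\{x\in\mathbb R^n:|\mathcal Tf(x)|>\lambda\})\le\frac{C_1}{\lambda}\int_{\mathbb R^n}|f(y)|w(y)\,dy,$$ then for $1\le\alpha<p\le\infty$, $\mathcal T$ is bounded from $(L^1(w),L^p)^\alpha$ to $(L^{1,\infty}(w),L^p)^\alpha$; i.e. there is $C>0$ with $\|\mathcal Tf\|_{(L^{1,\infty}(w),L^p)^\alpha}\le C\|f\|_{(L^1(w),L^p)^\alpha}$ for all $f\in(L^1(w),L^p)^\alpha$.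
   Context: A weight is a positive locally integrable measurable function $w$ on $\mathbb R^n$; $w(E)=\int_E w(x)\,dx$, $|E|$ is Lebesgue measure, $B(y,r)$ is the Euclidean ball of center $y$ and radius $r$, $\lambda B$ is the ball with the same center as $B$ and $\lambda$ times its radius, and $E^c$ is the complement of $E$. $\|f\|_{L^q(w)}=\left(\int_{\mathbb R^n}|f|^q w\,dx\right)^{1/q}$, $\|f\|_{L^{1,\infty}(w)}=\sup_{\lambda>0}\lambda\, w(\{x\in\mathbb R^n:|f(x)|>\lambda\})$, and $L^q_{\mathrm{loc}}(w)$ is the space of measurable $f$ with $\int_B|f|^qw\,dx<\infty$ for every ball $B$. An operator $\mathcal T$ is sublinear if $|\mathcal T(f+g)|\le|\mathcal Tf|+|\mathcal Tg|$ and $|\mathcal T(cf)|=|c||\mathcal Tf|$ for scalars $c$ (a.e.). Muckenhoupt classes: for $1<t<\infty$, $w\in\mathcal A_t$ if there is $C>0$ with $\left(\frac1{|B|}\int_B w\,dx\right)\left(\frac1{|B|}\int_B w^{-t'/t}\,dx\right)^{t/t'}\le C$ for all balls $B$, where $\frac1t+\frac1{t'}=1$; $w\in\mathcal A_1$ if there is $C>0$ with $\frac1{|B|}\int_B w\,dx\le C\,\mathrm{ess\,inf}_{x\in B}w(x)$ for all balls $B$. For $1\le q\le\alpha\le p\le\infty$ and a weight $w$, $(L^q(w),L^p)^\alpha$ is the space of measurable functions $f$ on $\mathbb R^n$ with $\|f\|_{(L^q(w),L^p)^\alpha}<\infty$, where $$\|f\|_{(L^q(w),L^p)^\alpha}=\sup_{r>0}\left[\int_{\mathbb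 R^n}\left(w(B(y,r))^{\frac1\alpha-\frac1q-\frac1p}\|f\chi_{B(y,r)}\|_{L^q(w)}\right)^p dy\right]^{1/p},$$ with the usual modification (essential supremum over $y$) when $p=\infty$. Likewise $$\|f\|_{(L^{1,\infty}(w),L^p)^\alpha}=\sup_{r>0}\left[\int_{\mathbb R^n}\left(w(B(y,r))^{\frac1\alpha-1-\frac1p}\|f\chi_{B(y,r)}\|_{L^{1,\infty}(w)}\right)^p dy\right]^{1/p},$$ with the same modification when $p=\infty$. *)

theory Defs
  imports "HOL-Analysis.Analysis" "HOL-Probability.Essential_Supremum"
begin

text \<open>
  The space \<open>\<real>\<^sup>n\<close> is an arbitrary Euclidean space \<open>'a\<close>, and functions take values in a type \<open>'b\<close>
  of class \<open>real_normed_field\<close>, which covers the scalar fields \<open>real\<close> and \<open>complex\<close>.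
  Measurability is Lebesgue measurability, and all norms take values in \<open>ennreal\<close>.
\<close>

text \<open>Powers \<open>x\<^sup>a\<close> with \<open>0 \<le> x \<le> \<infinity>\<close>; only meant for exponents \<open>a > 0\<close>.\<close>

definition epowr :: "ennreal \<Rightarrow> real \<Rightarrow> ennreal" where
  "epowr x a = (if x = top then top else ennreal (enn2real x powr a))"

definition restr :: "('a \<Rightarrow> 'b::real_normed_field) \<Rightarrow> 'a set \<Rightarrow> 'a \<Rightarrow> 'b" where
  "restr f E = (\<lambda>x. of_real (indicator E x) * f x)"

definition essinf_on :: "'a::euclidean_space set \<Rightarrow> ('a \<Rightarrow> real) \<Rightarrow> ennreal" where
  "essinf_on E f = Sup {c. AE x in lebesgue. x \<in> E \<longrightarrow> c \<le> ennreal (f x)}"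

definition mean_on :: "'a::euclidean_space set \<Rightarrow> ('a \<Rightarrow> ennreal) \<Rightarrow> ennreal" where
  "mean_on E g = (\<integral>\<^sup>+x\<in>E. g x \<partial>lebesgue) / emeasure lebesgue E"

subsection \<open>Weights and Muckenhoupt classes\<close>

definition wmeas :: "('a::euclidean_space \<Rightarrow> real) \<Rightarrow> 'a set \<Rightarrow> ennreal" where
  "wmeas w E = (\<integral>\<^sup>+x\<in>E. ennreal (w x) \<partial>lebesgue)"

text \<open>As usual, positivity is only required almost everywhere.\<close>

definition weight :: "('a::euclidean_space \<Rightarrow> real) \<Rightarrow> bool" where
  "weight w \<longleftrightarrow> w \<in> borel_measurable lebesgue \<and> (AE x in lebesgue. 0 < w x) \<and>
     (\<forall>y r. wmeas w (ball y r) < top)"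

definition conj_exp :: "real \<Rightarrow> real" where
  "conj_exp t = t / (t - 1)"

text \<open>Only meant for \<open>t \<ge> 1\<close>.\<close>

definition muckenhoupt :: "real \<Rightarrow> ('a::euclidean_space \<Rightarrow> real) set" where
  "muckenhoupt t = {w. weight w \<and> (\<exists>C>0. \<forall>y. \<forall>r>0.
     (if t = 1
      then mean_on (ball y r) (\<lambda>x. ennreal (w x)) \<le> ennreal C * essinf_on (ball y r) w
      else mean_on (ball y r) (\<lambda>x. ennreal (w x)) *
           epowr (mean_on (ball y r) (\<lambda>x. ennreal (w x powr (- (conj_exp t / t))))) (t / conj_exp t)
             \<le> ennreal C))}"

subsection \<open>Weighted Lebesgue spaces\<close>

definition Lq_norm :: "real \<Rightarrow> ('a::euclidean_space \<Rightarrow> real) \<Rightarrow> ('a \<Rightarrow> 'b::real_normed_field) \<Rightarrow> ennreal" where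
  "Lq_norm q w f = epowr (\<integral>\<^sup>+x. ennreal (norm (f x) powr q) * ennreal (w x) \<partial>lebesgue) (1 / q)"

definition weakL1_norm :: "('a::euclidean_space \<Rightarrow> real) \<Rightarrow> ('a \<Rightarrow> 'b::real_normed_field) \<Rightarrow> ennreal" where
  "weakL1_norm w f = (SUP l\<in>{0<..}. ennreal l * wmeas w {x. norm (f x) > l})"

definition Lq :: "real \<Rightarrow> ('a::euclidean_space \<Rightarrow> real) \<Rightarrow> ('a \<Rightarrow> 'b::real_normed_field) set" where
  "Lq q w = {f \<in> borel_measurable lebesgue. Lq_norm q w f < top}"

definition Lq_loc :: "real \<Rightarrow> ('a::euclidean_space \<Rightarrow> real) \<Rightarrow> ('a \<Rightarrow> 'b::real_normed_field) set" where
  "Lq_loc q w = {f \<in> borel_measurable lebesgue.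
     \<forall>y r. (\<integral>\<^sup>+x\<in>ball y r. ennreal (norm (f x) powr q) * ennreal (w x) \<partial>lebesgue) < top}"

subsection \<open>The spaces \<open>(L\<^sup>q(w), L\<^sup>p)\<^sup>\<alpha>\<close> and \<open>(L\<^sup>1\<^sup>,\<^sup>\<infinity>(w), L\<^sup>p)\<^sup>\<alpha>\<close>\<close>

text \<open>\<open>1/p\<close> for \<open>0 < p \<le> \<infinity>\<close>, with \<open>1/\<infinity> = 0\<close>.\<close>

definition recip :: "ennreal \<Rightarrow> real" where
  "recip p = enn2real (inverse p)"

definition Lp_norm_ext :: "ennreal \<Rightarrow> ('a::euclidean_space \<Rightarrow> ennreal) \<Rightarrow> ennreal" where
  "Lp_norm_ext p g =
     (if p = top then esssup lebesgue g
      else epowr (\<integral>\<^sup>+y. epowr (g y) (enn2real p) \<partial>lebesgue) (1 / enn2real p))"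

text \<open>
  The amalgam construction for a local norm \<open>N\<close> with exponent \<open>q\<close>. For a weight, \<open>w(B(y,r))\<close> is
  positive and finite, so its power, whose exponent may have either sign, is taken in the reals.
\<close>

definition amalgam_norm_of ::
  "(('a::euclidean_space \<Rightarrow> 'b::real_normed_field) \<Rightarrow> ennreal) \<Rightarrow> real \<Rightarrow> ('a \<Rightarrow> real) \<Rightarrow>
   ennreal \<Rightarrow> ennreal \<Rightarrow> ('a \<Rightarrow> 'b) \<Rightarrow> ennreal" where
  "amalgam_norm_of N q w p \<alpha> f =
     (SUP r\<in>{0<..}. Lp_norm_ext p (\<lambda>y.
        ennreal (enn2real (wmeas w (ball y r)) powr (recip \<alpha> - 1 / q - recip p)) *
        N (restr f (ball y r))))"

definition amalgam_norm :: "real \<Rightarrow> ('a::euclidean_space \<Rightarrow> real) \<Rightarrow> ennreal \<Rightarrow> ennreal \<Rightarrow>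
    ('a \<Rightarrow> 'b::real_normed_field) \<Rightarrow> ennreal" where
  "amalgam_norm q w p \<alpha> = amalgam_norm_of (Lq_norm q w) q w p \<alpha>"

definition amalgam :: "real \<Rightarrow> ('a::euclidean_space \<Rightarrow> real) \<Rightarrow> ennreal \<Rightarrow> ennreal \<Rightarrow>
    ('a \<Rightarrow> 'b::real_normed_field) set" where
  "amalgam q w p \<alpha> = {f \<in> borel_measurable lebesgue. amalgam_norm q w p \<alpha> f < top}"

definition weak_amalgam_norm :: "('a::euclidean_space \<Rightarrow> real) \<Rightarrow> ennreal \<Rightarrow> ennreal \<Rightarrow>
    ('a \<Rightarrow> 'b::real_normed_field) \<Rightarrow> ennreal" where
  "weak_amalgam_norm w p \<alpha> = amalgam_norm_of (weakL1_norm w) 1 w p \<alpha>"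

definition weak_amalgam :: "('a::euclidean_space \<Rightarrow> real) \<Rightarrow> ennreal \<Rightarrow> ennreal \<Rightarrow>
    ('a \<Rightarrow> 'b::real_normed_field) set" where
  "weak_amalgam w p \<alpha> = {f \<in> borel_measurable lebesgue. weak_amalgam_norm w p \<alpha> f < top}"

subsection \<open>Operators\<close>

definition sublinear_on :: "('a::euclidean_space \<Rightarrow> 'b::real_normed_field) set \<Rightarrow>
    (('a \<Rightarrow> 'b) \<Rightarrow> 'a \<Rightarrow> 'b) \<Rightarrow> bool" where
  "sublinear_on X T \<longleftrightarrow>
     (\<forall>f\<in>X. \<forall>g\<in>X. AE x in lebesgue. norm (T (\<lambda>z. f z + g z) x) \<le> norm (T f x) + norm (T g x)) \<and>
     (\<forall>c. \<forall>f\<in>X. AE x in lebesgue. norm (T (\<lambda>z. c * f z) x) = norm c * norm (T f x))"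

definition bounded_between :: "('f \<Rightarrow> 'g) \<Rightarrow> 'f set \<Rightarrow> ('f \<Rightarrow> ennreal) \<Rightarrow> 'g set \<Rightarrow> ('g \<Rightarrow> ennreal) \<Rightarrow> bool" where
  "bounded_between T X NX Y NY \<longleftrightarrow>
     T \<in> X \<rightarrow> Y \<and> (\<exists>C>0. \<forall>f\<in>X. NY (T f) \<le> ennreal C * NX f)"

end

theory Submission
  imports Defs
begin

text \<open>
  Fix a ball \<open>B = B(y,r)\<close> and split \<open>f\<close> into its restrictions to \<open>2B\<close> and to the complement of \<open>2B\<close>.
  On \<open>B\<close>, sublinearity bounds \<open>|T f|\<close> by \<open>|T (f \<chi>\<^bsub>2B\<^esub>)|\<close> plus a constant, the series of averages in the
  assumption on \<open>T\<close>. The first term is controlled by the strong or weak type bound of \<open>T\<close>, the second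
  is integrated over \<open>B\<close> (\<open>local_norm_le\<close>). The Muckenhoupt condition gives
  \<open>(|B|\<^sup>-\<^sup>1 \<integral>\<^bsub>B\<^esub> |f|\<^sup>s)\<^bsup>1/s\<^esup> \<le> C w(B)\<^bsup>-1/q\<^esup> \<parallel>f \<chi>\<^bsub>B\<^esub>\<parallel>\<close> in \<open>L\<^sup>q(w)\<close> for every ball (\<open>mean_on_powr_le\<close>). After
  multiplication by the power of \<open>w(B)\<close> that occurs in the amalgam norm, the \<open>k\<close>-th term of the series
  is the corresponding quantity of \<open>f\<close> for the ball \<open>2\<^bsup>k+1\<^esup>B\<close>, up to the factor
  \<open>k (w(B) / w(2\<^bsup>k+1\<^esup>B))\<^sup>\<beta>\<close> with \<open>\<beta> = 1/\<alpha> - 1/p > 0\<close>.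

  A Muckenhoupt weight also satisfies the reverse doubling property \<open>w(B) \<le> \<rho> w(2B)\<close> for some \<open>\<rho> < 1\<close>
  (\<open>muckenhoupt_doubling\<close>), because \<open>2B - B\<close> fills at least half of \<open>2B\<close>. So the factor is at most
  \<open>k \<rho>\<^bsup>(k+1)\<beta>\<^esup>\<close>, which is summable, and the triangle inequality in \<open>L\<^sup>p\<close> in the variable \<open>y\<close>
  (\<open>Lp_norm_ext_suminf_le\<close>) gives the bound, uniformly in \<open>r\<close>. It applies since the local norms are
  measurable functions of \<open>y\<close>. The part of \<open>f\<close> in \<open>2B\<close> needs ordinary doubling only.

  Of the local norm on the left-hand side the argument uses only what the norm of \<open>L\<^sup>q(w)\<close> and that of
  weak \<open>L\<^sup>1(w)\<close> have in common: the bound for sums with a constant, the bound for \<open>T\<close>, and the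
  measurability in the centre of the ball. Both parts of the theorem are therefore instances of \<open>amalgam_norm_of_operator_le\<close>.
\<close>

section \<open>Extended powers and the Hoelder inequality\<close>

lemma epowr_ennreal [simp]: "0 \<le> x \<Longrightarrow> epowr (ennreal x) a = ennreal (x powr a)"
  by (simp add: epowr_def)

lemma epowr_top [simp]: "epowr top a = top"
  by (simp add: epowr_def)

lemma epowr_zero [simp]: "epowr 0 a = 0"
  by (simp add: epowr_def)

lemma epowr_one_left [simp]: "epowr 1 a = 1"
  by (simp add: epowr_def)

lemma epowr_one [simp]: "epowr x 1 = x"
  by (cases x) auto

lemma epowr_eq_0_iff [simp]: "epowr x a = 0 \<longleftrightarrow> x = 0"
  by (cases x) auto

lemma epowr_eq_top_iff [simp]: "epowr x a = top \<longleftrightarrow> x = top"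
  by (cases x) auto

lemma epowr_less_top_iff [simp]: "epowr x a < top \<longleftrightarrow> x < top"
  using epowr_eq_top_iff[of x a] by (simp add: less_top[symmetric])

lemma epowr_mono: "0 \<le> a \<Longrightarrow> x \<le> y \<Longrightarrow> epowr x a \<le> epowr y a"
  by (cases x; cases y) (auto intro!: powr_mono2 ennreal_leI simp: top_unique)

lemma epowr_mult: "epowr (x * y) a = epowr x a * epowr y a"
  by (cases x; cases y)
     (auto simp: ennreal_mult[symmetric] powr_mult ennreal_top_mult ennreal_mult_top)

lemma epowr_epowr: "epowr (epowr x a) b = epowr x (a * b)"
  by (cases x) (auto simp: powr_powr)

lemma epowr_add: "epowr x (a + b) = epowr x a * epowr x b"
  by (cases x) (auto simp: powr_add ennreal_mult)

lemma epowr_indicator: "epowr (indicator A x) a = indicator A x"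
  by (auto simp: indicator_def epowr_def)

lemma borel_measurable_epowr [measurable (raw)]:
  assumes "f \<in> borel_measurable M"
  shows "(\<lambda>x. epowr (f x) a) \<in> borel_measurable M"
proof (rule measurable_compose[OF assms])
  have "Measurable.pred borel (\<lambda>x::ennreal. x = top)"
    by (simp add: pred_def)
  then show "(\<lambda>x. epowr x a) \<in> borel \<rightarrow>\<^sub>M borel"
    unfolding epowr_def by measurable
qed

lemma epowr_add_le:
  assumes "0 < a"
  shows "epowr (x + y) a \<le> ennreal (2 powr a) * (epowr x a + epowr y a)"
proof -
  have "epowr (x + y) a \<le> epowr (2 * max x y) a"
    using assms by (intro epowr_mono) (auto simp: mult_2 intro: add_mono)
  also have "\<dots> = ennreal (2 powr a) * epowr (max x y) a"
    by (simp add: epowr_mult epowr_ennreal[of 2, simplified])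
  also have "\<dots> \<le> ennreal (2 powr a) * (epowr x a + epowr y a)"
    by (intro mult_left_mono) (auto simp: max_def intro: add_increasing add_increasing2)
  finally show ?thesis .
qed

lemma Young_epowr:
  assumes "1 < t"
  shows "x * y \<le> ennreal (1 / t) * epowr x t + ennreal (1 / conj_exp t) * epowr y (conj_exp t)"
proof -
  have t: "1 < conj_exp t" "1 / t + 1 / conj_exp t = 1"
    using assms by (auto simp: conj_exp_def field_simps)
  consider "x = top \<or> y = top" | a b where "x = ennreal a" "y = ennreal b" "0 \<le> a" "0 \<le> b"
    by (metis ennreal_cases)
  then show ?thesis
  proof cases
    case 1
    then show ?thesis using assms t by (auto simp: ennreal_mult_top)
  next
    case 2
    have "a * b \<le> a powr t / t + b powr conj_exp t / conj_exp t"
      using Youngs_inequality[of t "conj_exp t" a b] assms t 2 by auto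
    then show ?thesis using 2 assms t
      by (auto simp: ennreal_mult[symmetric] ennreal_plus[symmetric] simp del: ennreal_plus intro!: ennreal_leI)
  qed
qed

text \<open>Raised to the power \<open>t\<close>, the second factor gets the exponent \<open>t / t' = t - 1\<close>.\<close>

lemma nn_integral_Hoelder:
  assumes t: "1 < t" and [measurable]: "u \<in> borel_measurable M" "v \<in> borel_measurable M"
  shows "epowr (\<integral>\<^sup>+x. u x * v x \<partial>M) t
           \<le> (\<integral>\<^sup>+x. epowr (u x) t \<partial>M) * epowr (\<integral>\<^sup>+x. epowr (v x) (conj_exp t) \<partial>M) (t - 1)"
    (is "_ \<le> ?A * epowr ?B _")
proof -
  have t': "1 < conj_exp t" "1 / t + 1 / conj_exp t = 1" "t / conj_exp t = t - 1"
    using t by (auto simp: conj_exp_def field_simps)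
  consider "?A = 0 \<or> ?B = 0" | "?A \<noteq> 0" "?B = top" | "?A = top" "?B \<noteq> 0"
    | A B where "?A = ennreal A" "?B = ennreal B" "0 < A" "0 < B"
    by (metis ennreal_cases ennreal_less_zero_iff not_gr_zero)
  then show ?thesis
  proof cases
    case 1
    then have "(AE x in M. u x = 0) \<or> (AE x in M. v x = 0)"
      by (simp add: nn_integral_0_iff_AE)
    then have "AE x in M. u x * v x = 0"
      by (auto elim: eventually_mono)
    then have "(\<integral>\<^sup>+x. u x * v x \<partial>M) = 0"
      by (subst nn_integral_0_iff_AE) auto
    then show ?thesis by simp
  next
    case 2
    then show ?thesis by (simp add: ennreal_mult_top)
  next
    case 3
    then show ?thesis by (simp add: ennreal_top_mult)
  next
    case 4
    define a b where "a = A powr (1 / t)" and "b = B powr (1 / conj_exp t)"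
    have ab: "0 < a" "0 < b" "a powr t = A" "b powr conj_exp t = B" "b powr t = B powr (t - 1)"
      using 4 t t' by (auto simp: a_def b_def powr_powr)
    have "(\<integral>\<^sup>+x. u x * v x \<partial>M)
        = (\<integral>\<^sup>+x. ennreal (a * b) * ((ennreal (1 / a) * u x) * (ennreal (1 / b) * v x)) \<partial>M)"
    proof (intro nn_integral_cong)
      fix x
      have "ennreal (a * b) * ((ennreal (1 / a) * u x) * (ennreal (1 / b) * v x))
          = (ennreal (a * b) * ennreal (1 / a) * ennreal (1 / b)) * (u x * v x)"
        by (simp add: ac_simps)
      also have "ennreal (a * b) * ennreal (1 / a) * ennreal (1 / b) = 1"
        using ab by (simp add: ennreal_mult[symmetric])
      finally show "u x * v x = ennreal (a * b) * ((ennreal (1 / a) * u x) * (ennreal (1 / b) * v x))"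
        by simp
    qed
    also have "\<dots> \<le> (\<integral>\<^sup>+x. ennreal (a * b) * (ennreal (1 / t) * (ennreal (1 / A) * epowr (u x) t)
        + ennreal (1 / conj_exp t) * (ennreal (1 / B) * epowr (v x) (conj_exp t))) \<partial>M)"
    proof (intro nn_integral_mono mult_left_mono)
      fix x
      show "(ennreal (1 / a) * u x) * (ennreal (1 / b) * v x) \<le>
         ennreal (1 / t) * (ennreal (1 / A) * epowr (u x) t)
        + ennreal (1 / conj_exp t) * (ennreal (1 / B) * epowr (v x) (conj_exp t))"
        using Young_epowr[OF t, of "ennreal (1 / a) * u x" "ennreal (1 / b) * v x"] ab
        by (simp add: epowr_mult powr_divide)
    qed auto
    also have "\<dots> = ennreal (a * b) * (ennreal (1 / t) * (ennreal (1 / A) * ?A)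
        + ennreal (1 / conj_exp t) * (ennreal (1 / B) * ?B))"
      by (simp add: nn_integral_cmult nn_integral_add)
    also have "\<dots> = ennreal (a * b) * (ennreal (1 / t) + ennreal (1 / conj_exp t))"
      using 4 by (simp add: ennreal_mult[symmetric])
    also have "ennreal (1 / t) + ennreal (1 / conj_exp t) = 1"
      using t t' by (simp flip: ennreal_plus)
    finally have "epowr (\<integral>\<^sup>+x. u x * v x \<partial>M) t \<le> epowr (ennreal (a * b)) t"
      using t by (intro epowr_mono) auto
    also have "\<dots> = ?A * epowr ?B (t - 1)"
      using 4 ab by (simp add: powr_mult flip: ennreal_mult)
    finally show ?thesis .
  qed
qed

text \<open>
  Jensen's inequality for the discrete measure with weights \<open>c k\<close>. For \<open>p > 1\<close> it is the Hoelder
  inequality for counting measure with \<open>c k\<close> split into \<open>c k powr (1 / p)\<close> and \<open>c k powr (1 / p')\<close>,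
  where \<open>p'\<close> is the conjugate exponent.
\<close>

lemma epowr_suminf_le:
  assumes p: "1 \<le> p" and c: "\<And>k. 0 \<le> c k"
  shows "epowr (\<Sum>k. ennreal (c k) * F k) p
      \<le> epowr (\<Sum>k. ennreal (c k)) (p - 1) * (\<Sum>k. ennreal (c k) * epowr (F k) p)"
proof (cases "p = 1")
  case True
  show ?thesis
  proof (cases "(\<Sum>k. ennreal (c k)) = 0")
    case True
    then have c0: "ennreal (c k) = 0" for k
      using sum_le_suminf[of "\<lambda>k. ennreal (c k)" "{k}"] by (auto simp: summableI)
    show ?thesis unfolding c0 by simp
  next
    case False
    have "1 \<le> epowr (\<Sum>k. ennreal (c k)) 0"
      using False by (cases "(\<Sum>k. ennreal (c k))") auto
    then show ?thesis using True
      by (auto intro: order_trans[OF _ mult_right_mono[where a = 1]])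
  qed
next
  case False
  then have p1: "1 < p" using p by simp
  have e: "1 / p + 1 / conj_exp p = 1" "conj_exp p \<noteq> 0"
    using p1 by (auto simp: conj_exp_def field_simps)
  let ?u = "\<lambda>k. ennreal (c k powr (1 / p)) * F k" and ?v = "\<lambda>k. ennreal (c k powr (1 / conj_exp p))"
  have 1: "?u k * ?v k = ennreal (c k) * F k" for k
  proof -
    have "?u k * ?v k = ennreal (c k powr (1 / p) * c k powr (1 / conj_exp p)) * F k"
      by (simp add: ennreal_mult ac_simps)
    also have "c k powr (1 / p) * c k powr (1 / conj_exp p) = c k"
      using c[of k] e by (simp flip: powr_add)
    finally show ?thesis .
  qed
  have 2: "epowr (?u k) p = ennreal (c k) * epowr (F k) p" for k
    using c[of k] p1 by (simp add: epowr_mult powr_powr)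
  have 3: "epowr (?v k) (conj_exp p) = ennreal (c k)" for k
    using c[of k] e by (simp add: powr_powr)
  show ?thesis
    using nn_integral_Hoelder[OF p1, of ?u "count_space UNIV" ?v]
    unfolding 1 2 3 nn_integral_count_space_nat by (simp add: mult.commute)
qed

section \<open>Lebesgue measure and integrals over moving balls\<close>

lemma sigma_finite_measure_lebesgue: "sigma_finite_measure (lebesgue :: 'a::euclidean_space measure)"
proof
  have "emeasure lebesgue (ball (0::'a) (real n)) < top" for n
    using emeasure_lborel_ball_finite[of "0::'a" "real n"] by simp
  moreover have "(\<Union>n. ball (0::'a) (real n)) = UNIV"
    by (auto simp: reals_Archimedean2)
  ultimately show "\<exists>A::'a set set. countable A \<and> A \<subseteq> sets lebesgue \<and> \<Union>A = space lebesgue \<and>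
      (\<forall>a\<in>A. emeasure lebesgue a \<noteq> \<infinity>)"
    by (intro exI[of _ "range (\<lambda>n. ball 0 (real n))"]) (auto simp: less_top)
qed

lemma borel_measurable_nn_integral_ball:
  fixes g :: "'a::euclidean_space \<Rightarrow> ennreal"
  assumes [measurable]: "g \<in> borel_measurable lebesgue"
  shows "(\<lambda>y. \<integral>\<^sup>+x\<in>ball y r. g x \<partial>lebesgue) \<in> borel_measurable lebesgue"
proof -
  interpret sigma_finite_measure "lebesgue :: 'a measure" by (rule sigma_finite_measure_lebesgue)
  have "{z. dist (fst z) (snd z) < r} \<in> sets (borel :: ('a \<times> 'a) measure)"
    by (intro borel_open open_Collect_less continuous_intros)
  then have "{z. dist (fst z) (snd z) < r} \<in> sets (lborel \<Otimes>\<^sub>M lborel :: ('a \<times> 'a) measure)"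
    unfolding borel_prod[symmetric] by (simp cong: sets_pair_measure_cong)
  moreover have "(\<lambda>z. z) \<in> (lebesgue \<Otimes>\<^sub>M lebesgue) \<rightarrow>\<^sub>M (lborel \<Otimes>\<^sub>M lborel :: ('a \<times> 'a) measure)"
    using measurable_Pair[OF measurable_compose[OF measurable_fst id_borel_measurable_lebesgue]
        measurable_compose[OF measurable_snd id_borel_measurable_lebesgue]]
    by (simp cong: measurable_cong_sets add: id_def)
  ultimately have [measurable]: "{z. dist (fst z) (snd z) < r} \<in> sets (lebesgue \<Otimes>\<^sub>M lebesgue :: ('a \<times> 'a) measure)"
    by (auto dest: measurable_sets simp: space_pair_measure)
  have "(\<lambda>y. \<integral>\<^sup>+x. g x * indicator {z. dist (fst z) (snd z) < r} (y, x) \<partial>lebesgue) \<in> borel_measurable lebesgue"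
    by measurable
  then show ?thesis
    by (simp add: indicator_def ball_def)
qed

lemma sets_lebesgue_ball [measurable, simp]: "ball y r \<in> sets lebesgue"
  by (simp add: lmeasurable_ball fmeasurableD)

lemma not_AE_notin_ball:
  fixes y :: "'a::euclidean_space"
  assumes "0 < r"
  shows "\<not> (AE x in lebesgue. x \<notin> ball y r)"
proof
  assume "AE x in lebesgue. x \<notin> ball y r"
  then have "emeasure lebesgue (ball y r) = 0"
    by (subst (asm) AE_iff_measurable[of "ball y r"]) auto
  moreover have "0 < unit_ball_vol (real DIM('a)) * r ^ DIM('a)"
    using assms by simp
  ultimately show False
    using assms by (simp add: emeasure_ball ennreal_eq_0_iff not_le)
qed

section \<open>Muckenhoupt weights\<close>

text \<open>The measure \<open>w(B(y,r))\<close> as a real number.\<close>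

definition wball :: "('a::euclidean_space \<Rightarrow> real) \<Rightarrow> 'a \<Rightarrow> real \<Rightarrow> real" where
  "wball w y r = enn2real (wmeas w (ball y r))"

lemma wball_nonneg [simp]: "0 \<le> wball w y r"
  by (simp add: wball_def)

lemma weight_measurable: "weight w \<Longrightarrow> w \<in> borel_measurable lebesgue"
  by (simp add: weight_def)

lemma wmeas_ball: "weight w \<Longrightarrow> wmeas w (ball y r) = ennreal (wball w y r)"
  by (simp add: weight_def less_top wball_def)

lemma wball_pos:
  fixes y :: "'a::euclidean_space"
  assumes w: "weight w" and r: "0 < r"
  shows "0 < wball w y r"
proof -
  note [measurable] = weight_measurable[OF w]
  have "wmeas w (ball y r) \<noteq> 0"
  proof
    assume "wmeas w (ball y r) = 0"
    moreover have "(\<lambda>x. ennreal (w x) * indicator (ball y r) x) \<in> borel_measurable lebesgue"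
      by measurable
    ultimately have "AE x in lebesgue. ennreal (w x) * indicator (ball y r) x = 0"
      by (simp add: wmeas_def nn_integral_0_iff_AE)
    moreover have "AE x in lebesgue. 0 < w x"
      using w by (simp add: weight_def)
    ultimately have "AE x in lebesgue. x \<notin> ball y r"
      by eventually_elim (auto simp: indicator_def ennreal_eq_0_iff split: if_splits)
    then show False
      using not_AE_notin_ball[OF r] by blast
  qed
  then show ?thesis
    using w by (auto simp: weight_def wball_def enn2real_positive_iff zero_less_iff_neq_zero)
qed

lemma AE_essinf_on_le: "AE x in lebesgue. x \<in> E \<longrightarrow> essinf_on E f \<le> ennreal (f x)"
proof -
  let ?S = "{c. AE x in lebesgue. x \<in> E \<longrightarrow> c \<le> ennreal (f x)}"
  have "?S \<noteq> {}"
    by (auto intro!: exI[of _ 0])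
  from ennreal_Sup_countable_SUP[OF this] obtain c :: "nat \<Rightarrow> ennreal"
    where c: "range c \<subseteq> ?S" "Sup ?S = (SUP i. c i)"
    by blast
  then have "AE x in lebesgue. \<forall>i. x \<in> E \<longrightarrow> c i \<le> ennreal (f x)"
    by (subst AE_all_countable) auto
  then show ?thesis
    unfolding essinf_on_def c(2) by eventually_elim (auto intro: SUP_least)
qed

text \<open>
  The Muckenhoupt condition in integrated form: on each ball, the average with respect to Lebesgue
  measure is controlled by the \<open>L\<^sup>t\<close> average with respect to \<open>w\<close>. All uses of the condition
  below go through this inequality.
\<close>

lemma muckenhoupt_mean_le:
  fixes w :: "'a::euclidean_space \<Rightarrow> real"
  assumes w: "w \<in> muckenhoupt t" and t: "1 \<le> t"
  shows "\<exists>C>0. \<forall>y. \<forall>r>0. \<forall>g\<in>borel_measurable lebesgue.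
      wmeas w (ball y r) * epowr (mean_on (ball y r) g) t
        \<le> ennreal C * (\<integral>\<^sup>+x\<in>ball y r. epowr (g x) t * ennreal (w x) \<partial>lebesgue)"
proof -
  from w have "weight w" by (simp add: muckenhoupt_def)
  then have [measurable]: "w \<in> borel_measurable lebesgue" and w_pos: "AE x in lebesgue. 0 < w x"
    by (auto simp: weight_def)
  from w obtain C where "0 < C" and C: "\<And>y r. 0 < r \<Longrightarrow> (if t = 1
      then mean_on (ball y r) (\<lambda>x. ennreal (w x)) \<le> ennreal C * essinf_on (ball y r) w
      else mean_on (ball y r) (\<lambda>x. ennreal (w x)) *
           epowr (mean_on (ball y r) (\<lambda>x. ennreal (w x powr (- (conj_exp t / t))))) (t / conj_exp t)
             \<le> ennreal C)"
    by (auto simp: muckenhoupt_def)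
  show ?thesis
  proof (intro exI[of _ C] conjI allI impI ballI \<open>0 < C\<close>)
    fix y :: 'a and r :: real and g :: "'a \<Rightarrow> ennreal"
    assume "0 < r" and [measurable]: "g \<in> borel_measurable lebesgue"
    let ?B = "ball y r"
    let ?G = "\<integral>\<^sup>+x\<in>?B. g x \<partial>lebesgue" and ?X = "\<integral>\<^sup>+x\<in>?B. epowr (g x) t * ennreal (w x) \<partial>lebesgue"
    obtain m where m: "0 < m" "emeasure lebesgue ?B = ennreal m"
      using \<open>0 < r\<close> by (auto simp: emeasure_ball intro!: that[of "unit_ball_vol (DIM('a)) * r ^ DIM('a)"])
    have mean: "mean_on ?B h = (\<integral>\<^sup>+x\<in>?B. h x \<partial>lebesgue) * ennreal (1 / m)" for h
      using m by (simp add: mean_on_def divide_ennreal_def inverse_ennreal inverse_eq_divide)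
    show "wmeas w ?B * epowr (mean_on ?B g) t \<le> ennreal C * ?X"
    proof (cases "t = 1")
      case True
      have "wmeas w ?B * epowr (mean_on ?B g) t = mean_on ?B (\<lambda>x. ennreal (w x)) * ?G"
        by (simp add: True mean wmeas_def ac_simps)
      also have "\<dots> \<le> ennreal C * essinf_on ?B w * ?G"
        using C[OF \<open>0 < r\<close>, of y] True by (intro mult_right_mono) auto
      also have "\<dots> = ennreal C * (\<integral>\<^sup>+x\<in>?B. essinf_on ?B w * g x \<partial>lebesgue)"
        by (simp add: nn_integral_cmult mult.assoc)
      also have "\<dots> \<le> ennreal C * ?X"
      proof (intro mult_left_mono nn_integral_mono_AE)
        show "AE x in lebesgue. essinf_on ?B w * g x * indicator ?B x
            \<le> epowr (g x) t * ennreal (w x) * indicator ?B x"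
          using AE_essinf_on_le[of ?B w]
          by eventually_elim (auto simp: True indicator_def mult.commute intro: mult_left_mono)
      qed auto
      finally show ?thesis .
    next
      case False
      with t have t1: "1 < t" by simp
      have e: "t / conj_exp t = t - 1" "conj_exp t > 0"
        using t1 by (auto simp: conj_exp_def field_simps)
      let ?V = "\<integral>\<^sup>+x\<in>?B. ennreal (w x powr (- (conj_exp t / t))) \<partial>lebesgue"
      \<comment> \<open>The Hoelder inequality for \<open>g = (g w\<^bsup>1/t\<^esup>) w\<^bsup>-1/t\<^esup>\<close> on the ball.\<close>
      let ?u = "\<lambda>x. g x * ennreal (w x powr (1 / t)) * indicator ?B x"
      let ?v = "\<lambda>x. ennreal (w x powr (- 1 / t)) * indicator ?B x"
      have "?G = (\<integral>\<^sup>+x. ?u x * ?v x \<partial>lebesgue)"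
      proof (rule nn_integral_cong_AE)
        show "AE x in lebesgue. g x * indicator ?B x = ?u x * ?v x"
          using w_pos
        proof eventually_elim
          case (elim x)
          then have "w x powr (1 / t) * w x powr (- 1 / t) = 1"
            by (simp flip: powr_add)
          then have "ennreal (w x powr (1 / t)) * ennreal (w x powr (- 1 / t)) = 1"
            by (simp flip: ennreal_mult)
          then show ?case
            by (auto simp: indicator_def mult.assoc)
        qed
      qed
      moreover have "(\<integral>\<^sup>+x. epowr (?u x) t \<partial>lebesgue) = ?X"
      proof (rule nn_integral_cong_AE)
        show "AE x in lebesgue. epowr (?u x) t = epowr (g x) t * ennreal (w x) * indicator ?B x"
          using w_pos by eventually_elim (use t1 in \<open>simp add: epowr_mult epowr_indicator powr_powr\<close>)
      qed
      moreover have "(\<integral>\<^sup>+x. epowr (?v x) (conj_exp t) \<partial>lebesgue) = ?V"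
        using t1 by (intro nn_integral_cong) (simp add: epowr_mult epowr_indicator powr_powr)
      ultimately have H: "epowr ?G t \<le> ?X * epowr ?V (t - 1)"
        using nn_integral_Hoelder[OF t1, of ?u lebesgue ?v] by simp
      have "ennreal (1 / m) * epowr (ennreal (1 / m)) (t - 1) = ennreal (1 / m powr t)"
        using m by (simp add: powr_diff powr_divide flip: ennreal_mult)
      then have M: "epowr (ennreal (1 / m)) t = ennreal (1 / m) * epowr (ennreal (1 / m)) (t - 1)"
        using m by (simp add: powr_divide)
      have "wmeas w ?B * epowr (mean_on ?B g) t
          = wmeas w ?B * (ennreal (1 / m) * epowr (ennreal (1 / m)) (t - 1)) * epowr ?G t"
        by (simp only: mean epowr_mult M ac_simps)
      also have "\<dots> \<le> wmeas w ?B * (ennreal (1 / m) * epowr (ennreal (1 / m)) (t - 1)) * (?X * epowr ?V (t - 1))"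
        by (intro mult_left_mono H) auto
      also have "\<dots> = (mean_on ?B (\<lambda>x. ennreal (w x)) *
           epowr (mean_on ?B (\<lambda>x. ennreal (w x powr (- (conj_exp t / t))))) (t - 1)) * ?X"
        by (simp only: mean epowr_mult wmeas_def ac_simps)
      also have "\<dots> \<le> ennreal C * ?X"
        using C[OF \<open>0 < r\<close>, of y] False e by (intro mult_right_mono) auto
      finally show ?thesis .
    qed
  qed
qed

lemma wmeas_mono: "A \<subseteq> B \<Longrightarrow> wmeas w A \<le> wmeas w B"
  unfolding wmeas_def by (intro nn_integral_mono mult_left_mono) (auto simp: indicator_def)

lemma wmeas_Un:
  assumes "weight w" and [measurable]: "A \<in> sets lebesgue" "B \<in> sets lebesgue" and "A \<inter> B = {}"
  shows "wmeas w (A \<union> B) = wmeas w A + wmeas w B"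
proof -
  note [measurable] = weight_measurable[OF assms(1)]
  have "wmeas w (A \<union> B) = (\<integral>\<^sup>+x. ennreal (w x) * indicator A x + ennreal (w x) * indicator B x \<partial>lebesgue)"
    unfolding wmeas_def using assms(4) by (intro nn_integral_cong) (auto simp: indicator_def)
  then show ?thesis
    by (simp add: wmeas_def nn_integral_add)
qed

text \<open>
  Testing the integrated condition on the characteristic functions of \<open>B\<close> and of \<open>2B - B\<close>, both of
  which fill a fixed proportion of \<open>2B\<close>.
\<close>

lemma muckenhoupt_doubling:
  fixes w :: "'a::euclidean_space \<Rightarrow> real"
  assumes w: "w \<in> muckenhoupt t" and t: "1 \<le> t"
  obtains D \<rho> where "0 < D" "0 < \<rho>" "\<rho> < 1"
    and "\<And>y r. 0 < r \<Longrightarrow> wball w y (2 * r) \<le> D * wball w y r"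
    and "\<And>y r. 0 < r \<Longrightarrow> wball w y r \<le> \<rho> * wball w y (2 * r)"
proof -
  from w have wt: "weight w" by (simp add: muckenhoupt_def)
  obtain C where "0 < C" and C: "\<And>y r g. 0 < r \<Longrightarrow> g \<in> borel_measurable lebesgue \<Longrightarrow>
      wmeas w (ball y r) * epowr (mean_on (ball y r) g) t
        \<le> ennreal C * (\<integral>\<^sup>+x\<in>ball y r. epowr (g x) t * ennreal (w x) \<partial>lebesgue)"
    using muckenhoupt_mean_le[OF w t] by blast
  let ?n = "DIM('a)"
  define v where "v = unit_ball_vol (real ?n)"
  have v: "0 < v" by (simp add: v_def)
  have test: "wball w y (2 * r) * a powr t \<le> C * enn2real (wmeas w E)"
    if "0 < r" and E: "E \<in> sets lebesgue" "E \<subseteq> ball y (2 * r)" and a: "0 \<le> a"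
      "emeasure lebesgue E = ennreal a * emeasure lebesgue (ball y (2 * r))" for y r E a
  proof -
    have m: "emeasure lebesgue (ball y (2 * r)) \<noteq> 0" "emeasure lebesgue (ball y (2 * r)) < top"
      using \<open>0 < r\<close> v by (auto simp: emeasure_ball v_def ennreal_eq_0_iff not_le)
    have "(\<integral>\<^sup>+x\<in>ball y (2 * r). indicator E x \<partial>lebesgue) = (\<integral>\<^sup>+x. indicator E x \<partial>lebesgue)"
      using E by (intro nn_integral_cong) (auto simp: indicator_def)
    also have "\<dots> = emeasure lebesgue E"
      using E by (intro nn_integral_indicator)
    finally have "(\<integral>\<^sup>+x\<in>ball y (2 * r). indicator E x \<partial>lebesgue) = emeasure lebesgue E" .
    then have "mean_on (ball y (2 * r)) (indicator E) = ennreal a"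
      using a m by (simp add: mean_on_def ennreal_mult_divide_eq)
    moreover have "(\<integral>\<^sup>+x\<in>ball y (2 * r). epowr (indicator E x) t * ennreal (w x) \<partial>lebesgue) = wmeas w E"
      unfolding wmeas_def using E by (intro nn_integral_cong) (auto simp: epowr_indicator indicator_def)
    moreover have "wmeas w E < top"
      using wmeas_mono[OF E(2), of w] wt by (auto simp: weight_def intro: le_less_trans)
    then have "wmeas w E = ennreal (enn2real (wmeas w E))" by simp
    ultimately have "ennreal (wball w y (2 * r)) * ennreal (a powr t) \<le> ennreal C * ennreal (enn2real (wmeas w E))"
      using C[of "2 * r" "indicator E" y] \<open>0 < r\<close> E a by (simp add: wmeas_ball[OF wt])
    then show ?thesis
      using \<open>0 < C\<close> by (simp add: ennreal_mult[symmetric])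
  qed
  define D where "D = C / (1 / 2 ^ ?n) powr t"
  \<comment> \<open>The maximum only serves to make \<open>\<rho>\<close> evidently positive.\<close>
  define \<rho> where "\<rho> = max (1 / 2) (1 - (1 / 2) powr t / C)"
  show ?thesis
  proof (rule that[of D \<rho>])
    show "0 < D" "0 < \<rho>" "\<rho> < 1"
      using \<open>0 < C\<close> by (auto simp: D_def \<rho>_def)
  next
    fix y :: 'a and r :: real assume r: "0 < r"
    have "wball w y (2 * r) * (1 / 2 ^ ?n) powr t \<le> C * enn2real (wmeas w (ball y r))"
    proof (rule test[OF r])
      show "emeasure lebesgue (ball y r) = ennreal (1 / 2 ^ ?n) * emeasure lebesgue (ball y (2 * r))"
        using r by (simp add: emeasure_ball power_mult_distrib flip: ennreal_mult)
    qed (use r in auto)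
    then show "wball w y (2 * r) \<le> D * wball w y r"
      by (simp add: D_def wball_def field_simps)
  next
    fix y :: 'a and r :: real assume r: "0 < r"
    let ?E = "ball y (2 * r) - ball y r"
    have "emeasure lebesgue ?E = ennreal (v * (2 * r) ^ ?n) - ennreal (v * r ^ ?n)"
      using r by (subst emeasure_Diff) (auto simp: emeasure_ball v_def)
    also have "\<dots> = ennreal (1 - 1 / 2 ^ ?n) * ennreal (v * (2 * r) ^ ?n)"
      using r v by (simp add: ennreal_minus power_mult_distrib field_simps flip: ennreal_mult)
    finally have E: "emeasure lebesgue ?E = ennreal (1 - 1 / 2 ^ ?n) * emeasure lebesgue (ball y (2 * r))"
      using r by (simp add: emeasure_ball v_def)
    \<comment> \<open>The dimension is at least 1.\<close>
    have half: "1 / 2 \<le> (1 - 1 / 2 ^ ?n :: real)"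
      using power_increasing[of 1 ?n "2::real"] by (simp add: field_simps Suc_leI)
    have "wball w y (2 * r) * (1 / 2) powr t \<le> wball w y (2 * r) * (1 - 1 / 2 ^ ?n) powr t"
      using half t by (intro mult_left_mono powr_mono2) auto
    also have "\<dots> \<le> C * enn2real (wmeas w ?E)"
      using half E by (intro test[OF r]) auto
    finally have 1: "wball w y (2 * r) * (1 / 2) powr t \<le> C * enn2real (wmeas w ?E)" .
    have sub: "ball y r \<union> ?E = ball y (2 * r)" using r by auto
    have "wmeas w (ball y (2 * r)) = wmeas w (ball y r) + wmeas w ?E"
      using wmeas_Un[OF wt, of "ball y r" ?E] by (simp only: sub) auto
    moreover have "wmeas w ?E < top"
      using wmeas_mono[of ?E "ball y (2 * r)" w] wt by (auto simp: weight_def intro: le_less_trans)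
    ultimately have "wball w y (2 * r) = wball w y r + enn2real (wmeas w ?E)"
      using wt by (simp add: weight_def wball_def enn2real_plus)
    with 1 have "wball w y r \<le> (1 - (1 / 2) powr t / C) * wball w y (2 * r)"
      using \<open>0 < C\<close> by (simp add: field_simps)
    also have "\<dots> \<le> \<rho> * wball w y (2 * r)"
      by (intro mult_right_mono) (auto simp: \<rho>_def)
    finally show "wball w y r \<le> \<rho> * wball w y (2 * r)" .
  qed
qed

section \<open>Local norms\<close>

lemma norm_restr: "norm (restr f E x) = indicator E x * norm (f x)"
  by (simp add: restr_def indicator_def)

lemma borel_measurable_restr [measurable]:
  fixes f :: "'a::euclidean_space \<Rightarrow> 'b::{real_normed_field, second_countable_topology}"
  assumes [measurable]: "f \<in> borel_measurable lebesgue" "E \<in> sets lebesgue"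
  shows "restr f E \<in> borel_measurable lebesgue"
proof -
  have "restr f E = (\<lambda>x. indicator E x *\<^sub>R f x)"
    by (auto simp: restr_def indicator_def)
  then show ?thesis by simp
qed

lemma Lq_norm_restr:
  "Lq_norm q w (restr f E) = epowr (\<integral>\<^sup>+x\<in>E. ennreal (norm (f x) powr q) * ennreal (w x) \<partial>lebesgue) (1 / q)"
  unfolding Lq_norm_def norm_restr
  by (intro arg_cong2[of _ _ _ _ epowr] nn_integral_cong refl) (auto simp: indicator_def)

text \<open>
  The averages in the assumption on the operator, bounded by the local norm: this is
  \<open>muckenhoupt_mean_le\<close> with \<open>t = q / s\<close> and \<open>g = |f|\<^sup>s\<close>.
\<close>

lemma mean_on_powr_le:
  fixes w :: "'a::euclidean_space \<Rightarrow> real"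
  assumes s: "1 \<le> s" "s \<le> q" and w: "w \<in> muckenhoupt (q / s)"
  obtains C where "0 < C"
    and "\<And>y r f. 0 < r \<Longrightarrow> f \<in> borel_measurable lebesgue \<Longrightarrow>
      epowr (mean_on (ball y r) (\<lambda>z. ennreal (norm (f z :: 'b::{real_normed_field, second_countable_topology}) powr s))) (1 / s)
        \<le> ennreal (C * wball w y r powr (- 1 / q)) * Lq_norm q w (restr f (ball y r))"
proof -
  from w have wt: "weight w" by (simp add: muckenhoupt_def)
  have t: "1 \<le> q / s" using s by simp
  obtain C where "0 < C" and C: "\<And>y r g. 0 < r \<Longrightarrow> g \<in> borel_measurable lebesgue \<Longrightarrow>
      wmeas w (ball y r) * epowr (mean_on (ball y r) g) (q / s)
        \<le> ennreal C * (\<integral>\<^sup>+x\<in>ball y r. epowr (g x) (q / s) * ennreal (w x) \<partial>lebesgue)"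
    using muckenhoupt_mean_le[OF w t] by blast
  show ?thesis
  proof (rule that[of "C powr (1 / q)"])
    show "0 < C powr (1 / q)" using \<open>0 < C\<close> by simp
    fix y :: 'a and r :: real and f :: "'a \<Rightarrow> 'b"
    assume r: "0 < r" and [measurable]: "f \<in> borel_measurable lebesgue"
    let ?W = "wball w y r" and ?m = "mean_on (ball y r) (\<lambda>z. ennreal (norm (f z) powr s))"
    have W: "0 < ?W" using wball_pos[OF wt r] .
    have "ennreal ?W * epowr ?m (q / s)
        \<le> ennreal C * (\<integral>\<^sup>+x\<in>ball y r. ennreal (norm (f x) powr q) * ennreal (w x) \<partial>lebesgue)"
      using C[OF r, of "\<lambda>z. ennreal (norm (f z) powr s)" y] s
      by (simp add: powr_powr wmeas_ball[OF wt])
    then have "epowr (ennreal ?W * epowr ?m (q / s)) (1 / q)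
        \<le> epowr (ennreal C * (\<integral>\<^sup>+x\<in>ball y r. ennreal (norm (f x) powr q) * ennreal (w x) \<partial>lebesgue)) (1 / q)"
      using s by (intro epowr_mono) auto
    then have *: "ennreal (?W powr (1 / q)) * epowr ?m (1 / s)
        \<le> ennreal (C powr (1 / q)) * Lq_norm q w (restr f (ball y r))"
      using s \<open>0 < C\<close> W by (simp add: epowr_mult epowr_epowr Lq_norm_restr)
    have "?W powr (- 1 / q) * ?W powr (1 / q) = 1"
      using W by (simp flip: powr_add)
    then have "epowr ?m (1 / s) = ennreal (?W powr (- 1 / q)) * (ennreal (?W powr (1 / q)) * epowr ?m (1 / s))"
      by (simp add: mult.assoc[symmetric] flip: ennreal_mult)
    also have "\<dots> \<le> ennreal (?W powr (- 1 / q)) * (ennreal (C powr (1 / q)) * Lq_norm q w (restr f (ball y r)))"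
      by (intro mult_left_mono *) auto
    also have "\<dots> = ennreal (C powr (1 / q) * ?W powr (- 1 / q)) * Lq_norm q w (restr f (ball y r))"
      by (simp add: ennreal_mult ac_simps)
    finally show "epowr ?m (1 / s) \<le> ennreal (C powr (1 / q) * ?W powr (- 1 / q)) * Lq_norm q w (restr f (ball y r))" .
  qed
qed

text \<open>
  Both local norms, \<open>L\<^sup>q(w)\<close> and weak \<open>L\<^sup>1(w)\<close> (with \<open>q = 1\<close>), satisfy the same bound for a function
  which on a measurable set is dominated by another function plus a constant.
\<close>

lemma Lq_norm_restr_le:
  fixes g h :: "'a::euclidean_space \<Rightarrow> 'b::{real_normed_field, second_countable_topology}"
  assumes q: "1 \<le> q" and w: "weight w"
    and [measurable]: "h \<in> borel_measurable lebesgue" "E \<in> sets lebesgue"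
    and gh: "AE x in lebesgue. x \<in> E \<longrightarrow> ennreal (norm (g x)) \<le> ennreal (norm (h x)) + M"
  shows "Lq_norm q w (restr g E)
    \<le> ennreal (2 * 2 powr (1 / q)) * (Lq_norm q w h + epowr (wmeas w E) (1 / q) * M)"
proof -
  note [measurable] = weight_measurable[OF w]
  let ?I = "\<integral>\<^sup>+x. ennreal (norm (h x) powr q) * ennreal (w x) \<partial>lebesgue"
  have "(\<integral>\<^sup>+x\<in>E. ennreal (norm (g x) powr q) * ennreal (w x) \<partial>lebesgue)
      \<le> (\<integral>\<^sup>+x. ennreal (2 powr q) * (ennreal (norm (h x) powr q) * ennreal (w x)
            + epowr M q * (ennreal (w x) * indicator E x)) \<partial>lebesgue)"
  proof (rule nn_integral_mono_AE)
    show "AE x in lebesgue. ennreal (norm (g x) powr q) * ennreal (w x) * indicator E x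
        \<le> ennreal (2 powr q) * (ennreal (norm (h x) powr q) * ennreal (w x)
            + epowr M q * (ennreal (w x) * indicator E x))"
      using gh
    proof eventually_elim
      case (elim x)
      show ?case
      proof (cases "x \<in> E")
        case True
        have "ennreal (norm (g x) powr q) = epowr (ennreal (norm (g x))) q"
          by simp
        also have "\<dots> \<le> epowr (ennreal (norm (h x)) + M) q"
          using True elim q by (intro epowr_mono) auto
        also have "\<dots> \<le> ennreal (2 powr q) * (ennreal (norm (h x) powr q) + epowr M q)"
          using epowr_add_le[of q "ennreal (norm (h x))" M] q by simp
        finally have "ennreal (norm (g x) powr q) * ennreal (w x)
            \<le> ennreal (2 powr q) * (ennreal (norm (h x) powr q) + epowr M q) * ennreal (w x)"
          by (rule mult_right_mono) simp
        then show ?thesis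
          using True by (simp add: algebra_simps)
      qed simp
    qed
  qed
  also have "\<dots> = ennreal (2 powr q) * (?I + epowr M q * wmeas w E)"
    by (simp add: nn_integral_cmult nn_integral_add wmeas_def)
  finally have "Lq_norm q w (restr g E) \<le> epowr (ennreal (2 powr q) * (?I + epowr M q * wmeas w E)) (1 / q)"
    using q unfolding Lq_norm_restr by (intro epowr_mono) auto
  also have "\<dots> = 2 * epowr (?I + epowr M q * wmeas w E) (1 / q)"
    using q by (simp add: epowr_mult powr_powr)
  also have "\<dots> \<le> 2 * (ennreal (2 powr (1 / q)) * (epowr ?I (1 / q) + epowr (epowr M q * wmeas w E) (1 / q)))"
    using q by (intro mult_left_mono epowr_add_le) auto
  also have "\<dots> = ennreal (2 * 2 powr (1 / q)) * (Lq_norm q w h + epowr (wmeas w E) (1 / q) * M)"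
    using q by (simp add: Lq_norm_def epowr_mult epowr_epowr ennreal_mult ac_simps)
  finally show ?thesis .
qed

text \<open>
  If \<open>|g| > l\<close> at a point of \<open>E\<close>, then \<open>|h| > l / 2\<close> there or \<open>M \<ge> l / 2\<close>; the coefficient \<open>?c\<close> records
  whether the second alternative occurs.
\<close>

lemma weakL1_norm_restr_le:
  fixes g h :: "'a::euclidean_space \<Rightarrow> 'b::{real_normed_field, second_countable_topology}"
  assumes w: "weight w"
    and [measurable]: "h \<in> borel_measurable lebesgue" "E \<in> sets lebesgue"
    and gh: "AE x in lebesgue. x \<in> E \<longrightarrow> ennreal (norm (g x)) \<le> ennreal (norm (h x)) + M"
  shows "weakL1_norm w (restr g E) \<le> 2 * (weakL1_norm w h + wmeas w E * M)"
  unfolding weakL1_norm_def[of w "restr g E"]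
proof (rule SUP_least)
  fix l :: real assume "l \<in> {0<..}"
  then have l: "0 < l" by simp
  note [measurable] = weight_measurable[OF w]
  let ?H = "{x. norm (h x) > l / 2}"
  let ?c = "if ennreal (l / 2) \<le> M then 1 else 0 :: ennreal"
  have "wmeas w {x. norm (restr g E x) > l}
      \<le> (\<integral>\<^sup>+x. ennreal (w x) * indicator ?H x + ?c * (ennreal (w x) * indicator E x) \<partial>lebesgue)"
    unfolding wmeas_def
  proof (rule nn_integral_mono_AE)
    show "AE x in lebesgue. ennreal (w x) * indicator {x. norm (restr g E x) > l} x
        \<le> ennreal (w x) * indicator ?H x + ?c * (ennreal (w x) * indicator E x)"
      using gh
    proof eventually_elim
      case (elim x)
      show ?case
      proof (cases "norm (restr g E x) > l \<and> \<not> x \<in> ?H")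
        case True
        then have E: "x \<in> E" and "ennreal l \<le> ennreal (norm (g x))" "norm (h x) \<le> l / 2"
          using l by (cases "x \<in> E"; auto simp: norm_restr ennreal_leI)+
        have "ennreal l \<le> ennreal (norm (h x)) + M"
          using elim E by (intro order_trans[OF \<open>ennreal l \<le> ennreal (norm (g x))\<close>]) auto
        also have "\<dots> \<le> ennreal (l / 2) + M"
          using \<open>norm (h x) \<le> l / 2\<close> by (intro add_right_mono ennreal_leI)
        finally have "ennreal (l / 2) \<le> M"
          using l by (cases M) (auto simp: ennreal_le_iff simp flip: ennreal_plus)
        then show ?thesis using E by (auto simp: indicator_def)
      qed (auto simp: indicator_def intro: add_increasing2)
    qed
  qed
  also have "\<dots> = wmeas w ?H + ?c * wmeas w E"
    by (simp add: nn_integral_cmult nn_integral_add wmeas_def)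
  finally have "ennreal l * wmeas w {x. norm (restr g E x) > l}
      \<le> ennreal l * (wmeas w ?H + ?c * wmeas w E)"
    by (rule mult_left_mono) simp
  also have "\<dots> = 2 * (ennreal (l / 2) * wmeas w ?H + (?c * ennreal (l / 2)) * wmeas w E)"
  proof -
    have *: "ennreal l = 2 * ennreal (l / 2)"
      using l by (simp add: ennreal_mult[symmetric, of 2, simplified])
    show ?thesis unfolding * by (simp only: algebra_simps)
  qed
  also have "\<dots> \<le> 2 * (weakL1_norm w h + M * wmeas w E)"
  proof (intro mult_left_mono add_mono mult_right_mono)
    show "ennreal (l / 2) * wmeas w ?H \<le> weakL1_norm w h"
      unfolding weakL1_norm_def using l by (intro SUP_upper2[of "l / 2"]) auto
  qed auto
  finally show "ennreal l * wmeas w {x. norm (restr g E x) > l} \<le> 2 * (weakL1_norm w h + wmeas w E * M)"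
    by (simp only: mult.commute)
qed

lemma borel_measurable_wball:
  assumes "weight w"
  shows "(\<lambda>y. wball w y r) \<in> borel_measurable lebesgue"
proof -
  note [measurable] = weight_measurable[OF assms]
  have "(\<lambda>y. wmeas w (ball y r)) \<in> borel_measurable lebesgue"
    unfolding wmeas_def by (rule borel_measurable_nn_integral_ball) simp
  then show ?thesis unfolding wball_def by measurable
qed

lemma borel_measurable_Lq_norm_restr_ball:
  fixes f :: "'a::euclidean_space \<Rightarrow> 'b::{real_normed_field, second_countable_topology}"
  assumes w: "weight w" and [measurable]: "f \<in> borel_measurable lebesgue"
  shows "(\<lambda>y. Lq_norm q w (restr f (ball y r))) \<in> borel_measurable lebesgue"
proof -
  note [measurable] = weight_measurable[OF w]
  show ?thesis
    unfolding Lq_norm_restr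
    by (intro borel_measurable_epowr borel_measurable_nn_integral_ball) simp
qed

text \<open>
  The distribution function is right continuous, so rational levels suffice. A countable supremum
  is needed for the measurability in the centre of the ball.
\<close>

lemma weakL1_norm_eq_SUP_rat:
  fixes f :: "'a::euclidean_space \<Rightarrow> 'b::{real_normed_field, second_countable_topology}"
  assumes w: "weight w" and [measurable]: "f \<in> borel_measurable lebesgue"
  shows "weakL1_norm w f = (SUP l\<in>{0<..} \<inter> \<rat>. ennreal l * wmeas w {x. norm (f x) > l})"
    (is "_ = ?S")
proof (rule antisym)
  show "?S \<le> weakL1_norm w f"
    unfolding weakL1_norm_def by (rule SUP_subset_mono) auto
  note [measurable] = weight_measurable[OF w]
  have [measurable]: "{x. norm (f x) > l} \<in> sets lebesgue" for l
  proof -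
    have "{x \<in> space lebesgue. norm (f x) > l} \<in> sets lebesgue" by measurable
    then show ?thesis by simp
  qed
  define F where "F l = wmeas w {x. norm (f x) > l}" for l
  have F_mono: "F l' \<le> F l" if "l \<le> l'" for l l'
    unfolding F_def using that by (intro wmeas_mono) auto
  have F_dens: "F l = emeasure (density lebesgue (\<lambda>x. ennreal (w x))) {x. norm (f x) > l}" for l
    unfolding F_def wmeas_def by (subst emeasure_density) auto
  show "weakL1_norm w f \<le> ?S"
    unfolding weakL1_norm_def
  proof (rule SUP_least)
    fix l :: real assume "l \<in> {0<..}"
    then have l: "0 < l" by simp
    define A where "A n = {x. norm (f x) > l + inverse (real (Suc n))}" for n
    have "{x. norm (f x) > l} = (\<Union>n. A n)"
    proof safe
      fix x assume "l < norm (f x)"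
      then obtain n where "inverse (real (Suc n)) < norm (f x) - l"
        using reals_Archimedean[of "norm (f x) - l"] by auto
      then show "x \<in> (\<Union>n. A n)" by (auto simp: A_def intro!: exI[of _ n])
    next
      fix x n assume "x \<in> A n"
      moreover have "0 < inverse (real (Suc n))" by simp
      ultimately show "l < norm (f x)" by (simp only: A_def mem_Collect_eq)
    qed
    moreover have "incseq A"
    proof (rule incseq_SucI)
      fix n
      have "inverse (real (Suc (Suc n))) \<le> inverse (real (Suc n))"
        by (intro le_imp_inverse_le) auto
      then show "A n \<subseteq> A (Suc n)"
        unfolding A_def by (intro Collect_mono impI) linarith
    qed
    moreover have "range A \<subseteq> sets (density lebesgue (\<lambda>x. ennreal (w x)))"
      by (auto simp: A_def)
    ultimately have "F l = (SUP n. F (l + inverse (real (Suc n))))"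
      by (simp add: F_dens SUP_emeasure_incseq[symmetric] del: of_nat_Suc flip: A_def)
    then have "ennreal l * F l = (SUP n. ennreal l * F (l + inverse (real (Suc n))))"
      by (simp add: SUP_mult_left_ennreal)
    also have "\<dots> \<le> ?S"
    proof (rule SUP_least)
      fix n
      obtain l' where l': "l' \<in> \<rat>" "l < l'" "l' < l + inverse (real (Suc n))"
        using Rats_dense_in_real[of l "l + inverse (real (Suc n))"] by auto
      have "ennreal l * F (l + inverse (real (Suc n))) \<le> ennreal l' * F l'"
        using l l' by (intro mult_mono F_mono ennreal_leI) auto
      also have "\<dots> \<le> ?S"
        using l l' unfolding F_def by (intro SUP_upper) auto
      finally show "ennreal l * F (l + inverse (real (Suc n))) \<le> ?S" .
    qed
    finally show "ennreal l * wmeas w {x. norm (f x) > l} \<le> ?S"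
      by (simp add: F_def)
  qed
qed

lemma borel_measurable_weakL1_norm_restr_ball:
  fixes f :: "'a::euclidean_space \<Rightarrow> 'b::{real_normed_field, second_countable_topology}"
  assumes w: "weight w" and f [measurable]: "f \<in> borel_measurable lebesgue"
  shows "(\<lambda>y. weakL1_norm w (restr f (ball y r))) \<in> borel_measurable lebesgue"
proof -
  note [measurable] = weight_measurable[OF w]
  have *: "wmeas w {x. norm (restr f (ball y r) x) > l}
      = (\<integral>\<^sup>+x\<in>ball y r. (ennreal (w x) * indicator {x. norm (f x) > l} x) \<partial>lebesgue)" if "0 < l" for y l
    unfolding wmeas_def using that
    by (intro nn_integral_cong) (auto simp: norm_restr indicator_def)
  have "(\<lambda>y. SUP l\<in>{0<..} \<inter> \<rat>. ennreal l * wmeas w {x. norm (restr f (ball y r) x) > l}) \<in> borel_measurable lebesgue"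
  proof (intro borel_measurable_SUP borel_measurable_times_ennreal borel_measurable_const)
    show "countable ({0<..} \<inter> \<rat> :: real set)"
      by (intro countable_Int2 countable_rat)
    fix l :: real assume "l \<in> {0<..} \<inter> \<rat>"
    then show "(\<lambda>y. wmeas w {x. norm (restr f (ball y r) x) > l}) \<in> borel_measurable lebesgue"
      by (simp add: * borel_measurable_nn_integral_ball)
  qed
  then show ?thesis
    by (simp add: weakL1_norm_eq_SUP_rat[OF w borel_measurable_restr[OF f]])
qed

section \<open>Global norms\<close>

lemma enn2real_ge_1: "1 \<le> p \<Longrightarrow> p \<noteq> top \<Longrightarrow> 1 \<le> enn2real p"
  by (cases p) auto

text \<open>
  The triangle inequality for a weighted series of functions with uniformly bounded norms. For
  \<open>p < \<infinity>\<close> the inequality \<open>epowr_suminf_le\<close> gives it directly, without the Minkowski inequality.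
  Measurability of \<open>G\<close> matters for \<open>p = \<infinity>\<close>, where the essential supremum of a function that is
  not measurable is \<open>\<infinity>\<close>.
\<close>

lemma Lp_norm_ext_suminf_le:
  assumes p: "1 \<le> p"
    and [measurable]: "G \<in> borel_measurable lebesgue" "\<And>k. F k \<in> borel_measurable lebesgue"
    and c: "\<And>k. 0 \<le> c k" "(\<Sum>k. ennreal (c k)) \<le> ennreal C"
    and G: "\<And>y. G y \<le> (\<Sum>k. ennreal (c k) * F k y)"
    and F: "\<And>k. Lp_norm_ext p (F k) \<le> K"
  shows "Lp_norm_ext p G \<le> ennreal C * K"
proof (cases "p = top")
  case True
  have "AE y in lebesgue. \<forall>k. F k y \<le> K"
    unfolding AE_all_countable
  proof
    fix k
    have "esssup lebesgue (F k) \<le> K" using F[of k] True by (simp add: Lp_norm_ext_def)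
    with esssup_AE[of "F k" lebesgue] show "AE y in lebesgue. F k y \<le> K"
      by (auto elim: eventually_mono)
  qed
  then have "AE y in lebesgue. G y \<le> ennreal C * K"
  proof eventually_elim
    case (elim y)
    have "G y \<le> (\<Sum>k. ennreal (c k) * F k y)" by (rule G)
    also have "\<dots> \<le> (\<Sum>k. ennreal (c k) * K)"
      using elim by (intro suminf_le summableI mult_left_mono) auto
    also have "\<dots> \<le> ennreal C * K"
      using c by (simp add: mult_right_mono)
    finally show ?case .
  qed
  then show ?thesis
    using True by (auto simp: Lp_norm_ext_def intro: esssup_I)
next
  case False
  define P where "P = enn2real p"
  have P: "1 \<le> P" using enn2real_ge_1[OF p False] by (simp add: P_def)
  have L: "Lp_norm_ext p h = epowr (\<integral>\<^sup>+y. epowr (h y) P \<partial>lebesgue) (1 / P)" for h :: "'a \<Rightarrow> ennreal"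
    using False by (simp add: Lp_norm_ext_def P_def)
  have F': "(\<integral>\<^sup>+y. epowr (F k y) P \<partial>lebesgue) \<le> epowr K P" for k
    using epowr_mono[of P, OF _ F[of k]] P by (simp add: L epowr_epowr)
  have "(\<integral>\<^sup>+y. epowr (G y) P \<partial>lebesgue)
      \<le> (\<integral>\<^sup>+y. epowr (ennreal C) (P - 1) * (\<Sum>k. ennreal (c k) * epowr (F k y) P) \<partial>lebesgue)"
  proof (rule nn_integral_mono)
    fix y
    have "epowr (G y) P \<le> epowr (\<Sum>k. ennreal (c k) * F k y) P"
      using P by (intro epowr_mono G) auto
    also have "\<dots> \<le> epowr (\<Sum>k. ennreal (c k)) (P - 1) * (\<Sum>k. ennreal (c k) * epowr (F k y) P)"
      using P c by (intro epowr_suminf_le)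
    also have "\<dots> \<le> epowr (ennreal C) (P - 1) * (\<Sum>k. ennreal (c k) * epowr (F k y) P)"
      using P c by (intro mult_right_mono epowr_mono) auto
    finally show "epowr (G y) P \<le> epowr (ennreal C) (P - 1) * (\<Sum>k. ennreal (c k) * epowr (F k y) P)" .
  qed
  also have "\<dots> = epowr (ennreal C) (P - 1) * (\<Sum>k. ennreal (c k) * (\<integral>\<^sup>+y. epowr (F k y) P \<partial>lebesgue))"
    by (simp add: nn_integral_cmult nn_integral_suminf)
  also have "\<dots> \<le> epowr (ennreal C) (P - 1) * (\<Sum>k. ennreal (c k) * epowr K P)"
    by (intro mult_left_mono suminf_le summableI F') auto
  also have "\<dots> \<le> epowr (ennreal C) (P - 1) * (ennreal C * epowr K P)"
    using c by (intro mult_left_mono) (auto simp: mult_right_mono)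
  also have "\<dots> = epowr (ennreal C * K) P"
    using epowr_add[of "ennreal C" "P - 1" 1] by (simp add: epowr_mult mult.assoc)
  finally have "Lp_norm_ext p G \<le> epowr (epowr (ennreal C * K) P) (1 / P)"
    unfolding L using P by (intro epowr_mono) auto
  then show ?thesis using P by (simp add: epowr_epowr)
qed

lemma Lp_norm_ext_AE_finite:
  assumes p: "1 \<le> p" and [measurable]: "F \<in> borel_measurable lebesgue" and F: "Lp_norm_ext p F < top"
  shows "AE y in lebesgue. F y < top"
proof (cases "p = top")
  case True
  with F have "esssup lebesgue F < top" by (simp add: Lp_norm_ext_def)
  with esssup_AE[of F lebesgue] show ?thesis
    by (auto elim!: eventually_mono)
next
  case False
  with F have "(\<integral>\<^sup>+y. epowr (F y) (enn2real p) \<partial>lebesgue) \<noteq> \<infinity>"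
    by (simp add: Lp_norm_ext_def)
  from nn_integral_PInf_AE[OF _ this] show ?thesis
    by (auto simp: less_top[symmetric])
qed

text \<open>
  Finiteness of the norm bounds the local norms only for almost every centre. Since \<open>B(y,r)\<close> has
  positive measure, it contains such a centre \<open>z\<close>, and \<open>B(y,r)\<close> lies in \<open>B(z,2r)\<close>.
\<close>

lemma amalgam_subset_Lq_loc:
  fixes w :: "'a::euclidean_space \<Rightarrow> real"
    and f :: "'a \<Rightarrow> 'b::{real_normed_field, second_countable_topology}"
  assumes w: "weight w" and p: "1 \<le> p" and q: "0 < q" and f: "f \<in> amalgam q w p \<alpha>"
  shows "f \<in> Lq_loc q w"
proof -
  from f have [measurable]: "f \<in> borel_measurable lebesgue" and fin: "amalgam_norm q w p \<alpha> f < top"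
    by (auto simp: amalgam_def)
  note [measurable] = borel_measurable_wball[OF w] borel_measurable_Lq_norm_restr_ball[OF w]
  have "(\<integral>\<^sup>+x\<in>ball y r. ennreal (norm (f x) powr q) * ennreal (w x) \<partial>lebesgue) < top"
    (is "?I (ball y r) < _") for y r
  proof (cases "0 < r")
    case True
    let ?F = "\<lambda>z. ennreal (wball w z (2 * r) powr (recip \<alpha> - 1 / q - recip p)) * Lq_norm q w (restr f (ball z (2 * r)))"
    have "Lp_norm_ext p ?F \<le> amalgam_norm q w p \<alpha> f"
      unfolding amalgam_norm_def amalgam_norm_of_def wball_def
      using True by (intro SUP_upper2[of "2 * r"]) auto
    then have "Lp_norm_ext p ?F < top" using fin by (rule le_less_trans)
    then have AE: "AE z in lebesgue. ?F z < top"
      by (intro Lp_norm_ext_AE_finite[OF p]) measurable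
    have "\<exists>z\<in>ball y r. ?F z < top"
    proof (rule ccontr)
      assume "\<not> (\<exists>z\<in>ball y r. ?F z < top)"
      with AE have "AE z in lebesgue. z \<notin> ball y r"
        by (auto elim!: eventually_mono)
      then show False
        using not_AE_notin_ball[OF True] by blast
    qed
    then obtain z where z: "z \<in> ball y r" "?F z < top" by blast
    have "0 < wball w z (2 * r)" using wball_pos[OF w] True by simp
    then have "Lq_norm q w (restr f (ball z (2 * r))) < top"
      using z(2) by (auto simp: less_top[symmetric] ennreal_mult_eq_top_iff ennreal_eq_0_iff)
    then have "?I (ball z (2 * r)) < top"
      by (simp add: Lq_norm_restr)
    moreover have "ball y r \<subseteq> ball z (2 * r)"
    proof
      fix x assume "x \<in> ball y r"
      then show "x \<in> ball z (2 * r)"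
        using z(1) dist_triangle[of z x y] by (simp add: dist_commute)
    qed
    then have "?I (ball y r) \<le> ?I (ball z (2 * r))"
      by (intro nn_integral_mono mult_left_mono) (auto simp: indicator_def)
    ultimately show ?thesis by (rule le_less_trans[rotated])
  qed (simp add: ball_empty)
  then show ?thesis by (auto simp: Lq_loc_def)
qed

section \<open>Boundedness on the amalgam spaces\<close>

lemma Lq_loc_restr:
  fixes f :: "'a::euclidean_space \<Rightarrow> 'b::{real_normed_field, second_countable_topology}"
  assumes f: "f \<in> Lq_loc q w" and E: "E \<in> sets lebesgue"
  shows "restr f E \<in> Lq_loc q w"
proof -
  have "(\<integral>\<^sup>+x\<in>ball y r. ennreal (norm (restr f E x) powr q) * ennreal (w x) \<partial>lebesgue) < top" for y r
  proof -
    have "(\<integral>\<^sup>+x\<in>ball y r. ennreal (norm (restr f E x) powr q) * ennreal (w x) \<partial>lebesgue)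
        \<le> (\<integral>\<^sup>+x\<in>ball y r. ennreal (norm (f x) powr q) * ennreal (w x) \<partial>lebesgue)"
      by (intro nn_integral_mono) (auto simp: norm_restr indicator_def)
    also have "\<dots> < top" using f by (simp add: Lq_loc_def)
    finally show ?thesis .
  qed
  then show ?thesis
    using f E by (auto simp: Lq_loc_def borel_measurable_restr)
qed

lemma restr_ball_in_Lq:
  fixes f :: "'a::euclidean_space \<Rightarrow> 'b::{real_normed_field, second_countable_topology}"
  assumes "f \<in> Lq_loc q w"
  shows "restr f (ball y r) \<in> Lq q w"
  using assms by (simp add: Lq_def Lq_loc_def borel_measurable_restr Lq_norm_restr)

text \<open>
  The operator bound on the local norms. Here \<open>N\<close> stands for the norm of \<open>L\<^sup>q(w)\<close> or of weak \<open>L\<^sup>1(w)\<close>.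
\<close>

lemma local_norm_le:
  fixes w :: "'a::euclidean_space \<Rightarrow> real"
    and T :: "('a \<Rightarrow> 'b::{real_normed_field, second_countable_topology}) \<Rightarrow> 'a \<Rightarrow> 'b"
  assumes T: "T \<in> Lq_loc q w \<rightarrow> Lq_loc q w" and sub: "sublinear_on (Lq_loc q w) T"
    and tail: "AE x in lebesgue. x \<in> ball y r \<longrightarrow>
        ennreal (norm (T (restr f (- ball y (2 * r))) x)) \<le> M"
    and N: "\<And>g h. g \<in> borel_measurable lebesgue \<Longrightarrow> h \<in> borel_measurable lebesgue \<Longrightarrow>
        AE x in lebesgue. x \<in> ball y r \<longrightarrow> ennreal (norm (g x)) \<le> ennreal (norm (h x)) + M \<Longrightarrow>
        N (restr g (ball y r)) \<le> ennreal K * (N h + epowr (wmeas w (ball y r)) (1 / q) * M)"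
    and bdd: "\<And>f. f \<in> Lq q w \<Longrightarrow> N (T f) \<le> ennreal C1 * Lq_norm q w f"
    and f: "f \<in> Lq_loc q w"
  shows "N (restr (T f) (ball y r)) \<le> ennreal K *
    (ennreal C1 * Lq_norm q w (restr f (ball y (2 * r))) + epowr (wmeas w (ball y r)) (1 / q) * M)"
proof -
  let ?f1 = "restr f (ball y (2 * r))" and ?f2 = "restr f (- ball y (2 * r))"
  have f12: "?f1 \<in> Lq_loc q w" "?f2 \<in> Lq_loc q w"
    using f by (auto intro!: Lq_loc_restr sets.compl_sets[of _ lebesgue, simplified] simp: Compl_eq_Diff_UNIV)
  have "(\<lambda>z. ?f1 z + ?f2 z) = f"
    by (auto simp: restr_def indicator_def)
  then have "AE x in lebesgue. norm (T f x) \<le> norm (T ?f1 x) + norm (T ?f2 x)"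
    using sub f12 unfolding sublinear_on_def by metis
  with tail have "AE x in lebesgue. x \<in> ball y r \<longrightarrow> ennreal (norm (T f x)) \<le> ennreal (norm (T ?f1 x)) + M"
  proof eventually_elim
    case (elim x)
    have "ennreal (norm (T f x)) \<le> ennreal (norm (T ?f1 x)) + ennreal (norm (T ?f2 x))"
      using elim(2) by (simp flip: ennreal_plus add: ennreal_leI)
    with elim(1) show ?case
      by (auto intro: order_trans add_left_mono)
  qed
  moreover have "T f \<in> borel_measurable lebesgue" "T ?f1 \<in> borel_measurable lebesgue"
    using T f f12 by (auto simp: Lq_loc_def)
  ultimately have "N (restr (T f) (ball y r))
      \<le> ennreal K * (N (T ?f1) + epowr (wmeas w (ball y r)) (1 / q) * M)"
    by (intro N)
  also have "\<dots> \<le> ennreal K * (ennreal C1 * Lq_norm q w ?f1 + epowr (wmeas w (ball y r)) (1 / q) * M)"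
    by (intro mult_left_mono add_right_mono bdd restr_ball_in_Lq f) auto
  finally show ?thesis .
qed

lemma recip_top [simp]: "recip top = 0"
  by (simp add: recip_def)

lemma recip_ennreal: "0 < x \<Longrightarrow> recip (ennreal x) = 1 / x"
  by (simp add: recip_def inverse_ennreal inverse_eq_divide)

lemma recip_less: "0 < \<alpha> \<Longrightarrow> \<alpha> < p \<Longrightarrow> recip p < recip \<alpha>"
  by (cases p; cases \<alpha>) (auto simp: recip_ennreal ennreal_less_iff frac_less2)

lemma recip_le: "0 < q \<Longrightarrow> ennreal q \<le> \<alpha> \<Longrightarrow> recip \<alpha> \<le> 1 / q"
  by (cases \<alpha>) (auto simp: recip_ennreal ennreal_le_iff frac_le)

text \<open>
  The common form of both parts of the theorem. The constants are \<open>\<beta> = 1/\<alpha> - 1/p > 0\<close>, the exponent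
  \<open>e = \<beta> - 1/q \<le> 0\<close> of \<open>w(B(y,r))\<close> in the norm, and the ratio \<open>\<sigma> = \<rho>\<^sup>\<beta> < 1\<close> with \<open>\<rho>\<close> from the reverse
  doubling property. The coefficient \<open>c 0\<close> belongs to the part of \<open>f\<close> in the doubled ball, and
  \<open>c (k + 1)\<close> to the \<open>k\<close>-th average over the balls of the tail.
\<close>

lemma amalgam_norm_of_operator_le:
  fixes w :: "'a::euclidean_space \<Rightarrow> real"
    and T :: "('a \<Rightarrow> 'b::{real_normed_field, second_countable_topology}) \<Rightarrow> 'a \<Rightarrow> 'b"
    and s q C0 K C1 :: real
  assumes sq: "1 \<le> s" "s \<le> q"
    and w: "w \<in> muckenhoupt (q / s)"
    and T: "T \<in> Lq_loc q w \<rightarrow> Lq_loc q w"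
    and sub: "sublinear_on (Lq_loc q w) T"
    and C0: "0 < C0"
    and tail: "\<And>y r f. 0 < r \<Longrightarrow> f \<in> Lq_loc q w \<Longrightarrow>
      AE x in lebesgue. x \<in> ball y r \<longrightarrow>
        ennreal (norm (T (restr f (- ball y (2 * r))) x))
          \<le> ennreal C0 * (\<Sum>k. of_nat (Suc k) *
              epowr (mean_on (ball y (2 ^ (Suc k + 1) * r)) (\<lambda>z. ennreal (norm (f z) powr s))) (1 / s))"
    and K: "0 < K"
    and N: "\<And>g h y r M. g \<in> borel_measurable lebesgue \<Longrightarrow> h \<in> borel_measurable lebesgue \<Longrightarrow>
        AE x in lebesgue. x \<in> ball y r \<longrightarrow> ennreal (norm (g x)) \<le> ennreal (norm (h x)) + M \<Longrightarrow>
        N (restr g (ball y r)) \<le> ennreal K * (N h + epowr (wmeas w (ball y r)) (1 / q) * M)"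
    and N_meas: "\<And>g r. g \<in> borel_measurable lebesgue \<Longrightarrow>
        (\<lambda>y. N (restr g (ball y r))) \<in> borel_measurable lebesgue"
    and C1: "0 < C1" and bdd: "\<And>f. f \<in> Lq q w \<Longrightarrow> N (T f) \<le> ennreal C1 * Lq_norm q w f"
    and \<alpha>p: "ennreal q \<le> \<alpha>" "\<alpha> < p"
  shows "\<exists>C>0. \<forall>f\<in>amalgam q w p \<alpha>. T f \<in> borel_measurable lebesgue \<and>
    amalgam_norm_of N q w p \<alpha> (T f) \<le> ennreal C * amalgam_norm q w p \<alpha> f"
proof -
  from w have wt: "weight w" by (simp add: muckenhoupt_def)
  have q: "1 \<le> q" and t: "1 \<le> q / s" using sq by auto
  have "1 \<le> \<alpha>" using q \<alpha>p(1) by (metis ennreal_1 ennreal_leI order_trans)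
  then have p: "1 \<le> p" using \<alpha>p(2) by simp
  obtain D \<rho> where D: "0 < D" and \<rho>: "0 < \<rho>" "\<rho> < 1"
    and doubling: "\<And>y r. 0 < r \<Longrightarrow> wball w y (2 * r) \<le> D * wball w y r"
    and reverse: "\<And>y r. 0 < r \<Longrightarrow> wball w y r \<le> \<rho> * wball w y (2 * r)"
    using muckenhoupt_doubling[OF w t] by metis
  obtain C3 where C3: "0 < C3" and mean: "\<And>y r f. 0 < r \<Longrightarrow> f \<in> borel_measurable lebesgue \<Longrightarrow>
      epowr (mean_on (ball y r) (\<lambda>z. ennreal (norm (f z :: 'b) powr s))) (1 / s)
        \<le> ennreal (C3 * wball w y r powr (- 1 / q)) * Lq_norm q w (restr f (ball y r))"
    using mean_on_powr_le[OF sq w, where 'b = 'b] by blast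
  have reverse_iter: "wball w y r \<le> \<rho> ^ j * wball w y (2 ^ j * r)" if "0 < r" for y r j
  proof (induction j)
    case (Suc j)
    note Suc
    also have "\<rho> ^ j * wball w y (2 ^ j * r) \<le> \<rho> ^ j * (\<rho> * wball w y (2 * (2 ^ j * r)))"
      using that \<rho> by (intro mult_left_mono reverse) auto
    finally show ?case by (simp add: ac_simps)
  qed simp
  define \<beta> where "\<beta> = recip \<alpha> - recip p"
  define e where "e = recip \<alpha> - 1 / q - recip p"
  have \<beta>: "0 < \<beta>"
    using recip_less[OF less_le_trans[OF zero_less_one \<open>1 \<le> \<alpha>\<close>] \<alpha>p(2)] by (simp add: \<beta>_def)
  have "0 \<le> recip p" by (simp add: recip_def)
  with recip_le[OF _ \<alpha>p(1)] q have e: "e \<le> 0" "e + 1 / q = \<beta>"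
    by (auto simp: e_def \<beta>_def)
  define \<sigma> where "\<sigma> = \<rho> powr \<beta>"
  have \<sigma>: "0 < \<sigma>" "\<sigma> < 1"
    using \<rho> \<beta> powr_less_mono2[of \<beta> \<rho> 1] by (auto simp: \<sigma>_def)
  have \<sigma>_power: "(\<rho> ^ n) powr \<beta> = \<sigma> ^ n" for n
    using \<rho> by (simp add: \<sigma>_def powr_powr mult.commute flip: powr_realpow)
  define c where "c k = (case k of 0 \<Rightarrow> K * C1 * D powr (- e)
      | Suc j \<Rightarrow> K * C0 * C3 * real (Suc j) * \<sigma> ^ (j + 2))" for k
  have c_nonneg: "0 \<le> c k" for k
    using K C1 C0 C3 \<sigma> by (auto simp: c_def split: nat.split)
  have "summable (\<lambda>j. (K * C0 * C3 * \<sigma> ^ 2) * (of_nat (Suc j) * \<sigma> ^ j))"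
    using geometric_deriv_sums[of \<sigma>] \<sigma> by (intro summable_mult) (auto simp: sums_iff)
  also have "(\<lambda>j. (K * C0 * C3 * \<sigma> ^ 2) * (of_nat (Suc j) * \<sigma> ^ j)) = (\<lambda>j. c (Suc j))"
    by (simp add: c_def power_add power2_eq_square ac_simps)
  finally have "summable (\<lambda>j. c (Suc j))" .
  then have c_sum: "summable c" by (subst (asm) summable_Suc_iff)
  \<comment> \<open>The summand 1 only serves to make the constant evidently positive.\<close>
  define C where "C = suminf c + 1"
  have "0 < C" using suminf_nonneg[OF c_sum c_nonneg] by (simp add: C_def)
  have c_le: "(\<Sum>k. ennreal (c k)) \<le> ennreal C"
    using suminf_ennreal2[OF c_nonneg c_sum] by (simp add: C_def ennreal_leI)
  show ?thesis
  proof (intro exI[of _ C] conjI ballI \<open>0 < C\<close>)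
    fix f :: "'a \<Rightarrow> 'b" assume fA: "f \<in> amalgam q w p \<alpha>"
    then have f: "f \<in> Lq_loc q w"
      using q by (intro amalgam_subset_Lq_loc[OF wt p]) auto
    have [measurable]: "f \<in> borel_measurable lebesgue" using f by (simp add: Lq_loc_def)
    show Tf: "T f \<in> borel_measurable lebesgue" using T f by (auto simp: Lq_loc_def)
    note [measurable] = borel_measurable_wball[OF wt] borel_measurable_Lq_norm_restr_ball[OF wt]
      N_meas[OF Tf]
    show "amalgam_norm_of N q w p \<alpha> (T f) \<le> ennreal C * amalgam_norm q w p \<alpha> f"
      unfolding amalgam_norm_of_def wball_def[symmetric] e_def[symmetric]
    proof (rule SUP_least)
      fix r :: real assume "r \<in> {0<..}"
      then have r: "0 < r" by simp
      define W where "W j y = wball w y (2 ^ j * r)" for j y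
      define X where "X j y = Lq_norm q w (restr f (ball y (2 ^ j * r)))" for j y
      \<comment> \<open>\<open>F k\<close> is the function in the norm of \<open>f\<close> for the radius \<open>2 ^ (k + 1) * r\<close>.\<close>
      define F where "F k y = ennreal (W (Suc k) y powr e) * X (Suc k) y" for k y
      have W: "0 < W j y" for j y using wball_pos[OF wt] r by (simp add: W_def)
      have pointwise: "ennreal (wball w y r powr e) * N (restr (T f) (ball y r))
          \<le> (\<Sum>k. ennreal (c k) * F k y)" for y
      proof -
        let ?w = "wball w y r"
        have w0: "0 < ?w" using wball_pos[OF wt r] .
        define S where "S = (\<Sum>k. of_nat (Suc k) *
              epowr (mean_on (ball y (2 ^ (Suc k + 1) * r)) (\<lambda>z. ennreal (norm (f z) powr s))) (1 / s))"
        have "N (restr (T f) (ball y r)) \<le> ennreal K *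
            (ennreal C1 * Lq_norm q w (restr f (ball y (2 * r)))
              + epowr (wmeas w (ball y r)) (1 / q) * (ennreal C0 * S))"
          unfolding S_def
          by (rule local_norm_le[OF T sub tail[OF r f] _ _ f]) (rule N bdd; assumption)+
        then have "N (restr (T f) (ball y r)) \<le> ennreal K *
            (ennreal C1 * X 1 y + ennreal (?w powr (1 / q)) * (ennreal C0 * S))"
          by (simp add: X_def wmeas_ball[OF wt])
        then have "ennreal (?w powr e) * N (restr (T f) (ball y r)) \<le> ennreal (?w powr e) * (ennreal K *
            (ennreal C1 * X 1 y + ennreal (?w powr (1 / q)) * (ennreal C0 * S)))"
          by (rule mult_left_mono) simp
        also have "\<dots> = ennreal (K * C1 * ?w powr e) * X 1 y + ennreal (K * C0 * ?w powr \<beta>) * S"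
          using K C1 C0 e(2)[symmetric]
          by (simp add: distrib_left ennreal_mult powr_add ac_simps)
        also have "\<dots> \<le> ennreal (c 0) * F 0 y + (\<Sum>k. ennreal (c (Suc k)) * F (Suc k) y)"
        proof (rule add_mono)
          \<comment> \<open>The exponent is nonpositive, so doubling is the direction needed here.\<close>
          have "?w powr e \<le> (W 1 y / D) powr e"
            using doubling[OF r, of y] D e W[of 1 y]
            by (intro powr_mono2') (auto simp: W_def field_simps)
          also have "\<dots> = D powr (- e) * W 1 y powr e"
            using D W[of 1 y] by (simp add: powr_divide powr_minus field_simps)
          finally have "K * C1 * ?w powr e \<le> c 0 * W 1 y powr e"
            using K C1 by (simp add: c_def)
          then have "ennreal (K * C1 * ?w powr e) * X 1 y \<le> ennreal (c 0 * W 1 y powr e) * X 1 y"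
            by (intro mult_right_mono ennreal_leI) auto
          also have "\<dots> = ennreal (c 0) * F 0 y"
            using c_nonneg[of 0] by (simp add: F_def ennreal_mult mult.assoc)
          finally show "ennreal (K * C1 * ?w powr e) * X 1 y \<le> ennreal (c 0) * F 0 y" .
        next
          have "ennreal (K * C0 * ?w powr \<beta>) * S = (\<Sum>k. ennreal (K * C0 * ?w powr \<beta>) * (of_nat (Suc k) *
              epowr (mean_on (ball y (2 ^ (Suc k + 1) * r)) (\<lambda>z. ennreal (norm (f z) powr s))) (1 / s)))"
            by (simp add: S_def)
          also have "\<dots> \<le> (\<Sum>k. ennreal (c (Suc k)) * F (Suc k) y)"
          proof (intro suminf_le summableI)
            fix k
            let ?W = "W (k + 2) y" and ?X = "X (k + 2) y"
            \<comment> \<open>Here the positive exponent \<open>\<beta>\<close> turns reverse doubling into geometric decay.\<close>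
            have "?w powr \<beta> \<le> (\<rho> ^ (k + 2) * ?W) powr \<beta>"
              using reverse_iter[OF r, of y "k + 2"] \<beta> w0 by (intro powr_mono2) (auto simp: W_def)
            also have "\<dots> = (\<rho> ^ (k + 2)) powr \<beta> * ?W powr \<beta>"
              using \<rho> W[of "k + 2" y] by (intro powr_mult)
            also have "(\<rho> ^ (k + 2)) powr \<beta> = \<sigma> ^ (k + 2)"
              by (rule \<sigma>_power)
            finally have "?w powr \<beta> * ?W powr (- 1 / q) \<le> \<sigma> ^ (k + 2) * ?W powr \<beta> * ?W powr (- 1 / q)"
              by (rule mult_right_mono) simp
            also have "\<dots> = \<sigma> ^ (k + 2) * ?W powr e"
              by (simp add: mult.assoc e(2)[symmetric] flip: powr_add)
            finally have *: "K * C0 * real (Suc k) * C3 * (?w powr \<beta> * ?W powr (- 1 / q))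
                \<le> K * C0 * real (Suc k) * C3 * (\<sigma> ^ (k + 2) * ?W powr e)"
              using K C0 C3 by (intro mult_left_mono) auto
            have "epowr (mean_on (ball y (2 ^ (Suc k + 1) * r)) (\<lambda>z. ennreal (norm (f z) powr s))) (1 / s)
                \<le> ennreal (C3 * ?W powr (- 1 / q)) * ?X"
              using mean[of "2 ^ (k + 2) * r" f y] r by (simp add: W_def X_def)
            then have "ennreal (K * C0 * ?w powr \<beta>) * (of_nat (Suc k) *
                epowr (mean_on (ball y (2 ^ (Suc k + 1) * r)) (\<lambda>z. ennreal (norm (f z) powr s))) (1 / s))
              \<le> ennreal (K * C0 * ?w powr \<beta>) * (ennreal (real (Suc k)) * (ennreal (C3 * ?W powr (- 1 / q)) * ?X))"
              by (subst ennreal_of_nat_eq_real_of_nat) (intro mult_left_mono; simp)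
            also have "\<dots> = ennreal (K * C0 * real (Suc k) * C3 * (?w powr \<beta> * ?W powr (- 1 / q))) * ?X"
              using K C0 C3 by (simp add: ennreal_mult ac_simps del: of_nat_Suc)
            also have "\<dots> \<le> ennreal (K * C0 * real (Suc k) * C3 * (\<sigma> ^ (k + 2) * ?W powr e)) * ?X"
              using * by (intro mult_right_mono ennreal_leI) auto
            also have "K * C0 * real (Suc k) * C3 * (\<sigma> ^ (k + 2) * ?W powr e) = c (Suc k) * ?W powr e"
              by (simp add: c_def ac_simps del: of_nat_Suc)
            also have "ennreal (c (Suc k) * ?W powr e) * ?X = ennreal (c (Suc k)) * F (Suc k) y"
              using c_nonneg[of "Suc k"] by (simp add: F_def ennreal_mult mult.assoc)
            finally show "ennreal (K * C0 * ?w powr \<beta>) * (of_nat (Suc k) *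
                epowr (mean_on (ball y (2 ^ (Suc k + 1) * r)) (\<lambda>z. ennreal (norm (f z) powr s))) (1 / s))
              \<le> ennreal (c (Suc k)) * F (Suc k) y" .
          qed
          finally show "ennreal (K * C0 * ?w powr \<beta>) * S \<le> (\<Sum>k. ennreal (c (Suc k)) * F (Suc k) y)" .
        qed
        also have "\<dots> = (\<Sum>k. ennreal (c k) * F k y)"
          using suminf_offset[of "\<lambda>k. ennreal (c k) * F k y" 1] by (simp add: summableI add.commute)
        finally show ?thesis .
      qed
      show "Lp_norm_ext p (\<lambda>y. ennreal (wball w y r powr e) * N (restr (T f) (ball y r)))
          \<le> ennreal C * amalgam_norm q w p \<alpha> f"
      proof (rule Lp_norm_ext_suminf_le[OF p _ _ c_nonneg c_le pointwise])
        fix k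
        show "F k \<in> borel_measurable lebesgue"
          unfolding F_def W_def X_def by measurable
        show "Lp_norm_ext p (F k) \<le> amalgam_norm q w p \<alpha> f"
          unfolding amalgam_norm_def amalgam_norm_of_def wball_def[symmetric] e_def[symmetric]
          using r by (intro SUP_upper2[of "2 ^ Suc k * r"]) (auto simp: F_def[abs_def] W_def X_def)
      qed measurable
    qed
  qed
qed

theorem lemma3p1:
  fixes w :: "'a::euclidean_space \<Rightarrow> real"
    and T :: "('a \<Rightarrow> 'b::{real_normed_field, second_countable_topology}) \<Rightarrow> 'a \<Rightarrow> 'b"
    and s q C0 :: real
  assumes "1 \<le> s" and "s \<le> q"
    and "w \<in> muckenhoupt (q / s)"
    and "T \<in> Lq_loc q w \<rightarrow> Lq_loc q w"
    and "sublinear_on (Lq_loc q w) T"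
    and "0 < C0"
    and "\<And>y r f. 0 < r \<Longrightarrow> f \<in> Lq_loc q w \<Longrightarrow>
      AE x in lebesgue. x \<in> ball y r \<longrightarrow>
        ennreal (norm (T (restr f (- ball y (2 * r))) x))
          \<le> ennreal C0 * (\<Sum>k. of_nat (Suc k) *
              epowr (mean_on (ball y (2 ^ (Suc k + 1) * r)) (\<lambda>z. ennreal (norm (f z) powr s))) (1 / s))"
  shows "(1 < q \<and> bounded_between T (Lq q w) (Lq_norm q w) (Lq q w) (Lq_norm q w) \<longrightarrow>
            (\<forall>\<alpha> p :: ennreal. ennreal q \<le> \<alpha> \<and> \<alpha> < p \<longrightarrow>
               bounded_between T (amalgam q w p \<alpha>) (amalgam_norm q w p \<alpha>)
                                 (amalgam q w p \<alpha>) (amalgam_norm q w p \<alpha>)))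
       \<and> (q = 1 \<and>
            (\<exists>C1>0. \<forall>l>0. \<forall>f\<in>Lq 1 w.
               wmeas w {x. norm (T f x) > l}
                 \<le> ennreal (C1 / l) * (\<integral>\<^sup>+y. ennreal (norm (f y)) * ennreal (w y) \<partial>lebesgue)) \<longrightarrow>
            (\<forall>\<alpha> p :: ennreal. 1 \<le> \<alpha> \<and> \<alpha> < p \<longrightarrow>
               bounded_between T (amalgam 1 w p \<alpha>) (amalgam_norm 1 w p \<alpha>)
                                 (weak_amalgam w p \<alpha>) (weak_amalgam_norm w p \<alpha>)))"
proof (intro conjI impI allI; elim conjE)
  from assms(3) have wt: "weight w" by (simp add: muckenhoupt_def)
  have q: "1 \<le> q" using assms(1,2) by simp
  fix \<alpha> p :: ennreal
  note main = amalgam_norm_of_operator_le[OF assms]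
  {
    assume "bounded_between T (Lq q w) (Lq_norm q w) (Lq q w) (Lq_norm q w)"
    then obtain C1 where C1: "0 < C1" "\<And>f. f \<in> Lq q w \<Longrightarrow> Lq_norm q w (T f) \<le> ennreal C1 * Lq_norm q w f"
      by (auto simp: bounded_between_def)
    assume \<alpha>p: "ennreal q \<le> \<alpha>" "\<alpha> < p"
    have "\<exists>C>0. \<forall>f\<in>amalgam q w p \<alpha>. T f \<in> borel_measurable lebesgue \<and>
        amalgam_norm_of (Lq_norm q w) q w p \<alpha> (T f) \<le> ennreal C * amalgam_norm q w p \<alpha> f"
    proof (rule main[of "2 * 2 powr (1 / q)" "Lq_norm q w" C1])
    qed (auto intro!: Lq_norm_restr_le q wt borel_measurable_Lq_norm_restr_ball C1 \<alpha>p)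
    then show "bounded_between T (amalgam q w p \<alpha>) (amalgam_norm q w p \<alpha>)
        (amalgam q w p \<alpha>) (amalgam_norm q w p \<alpha>)"
      unfolding bounded_between_def amalgam_norm_def[symmetric]
      by (auto simp: amalgam_def ennreal_mult_less_top intro: le_less_trans)
  next
    assume q1: "q = 1" and "\<exists>C1>0. \<forall>l>0. \<forall>f\<in>Lq 1 w. wmeas w {x. norm (T f x) > l}
      \<le> ennreal (C1 / l) * (\<integral>\<^sup>+y. ennreal (norm (f y)) * ennreal (w y) \<partial>lebesgue)"
    then obtain C1 where "0 < C1" and weak: "\<And>l f. 0 < l \<Longrightarrow> f \<in> Lq 1 w \<Longrightarrow> wmeas w {x. norm (T f x) > l}
      \<le> ennreal (C1 / l) * (\<integral>\<^sup>+y. ennreal (norm (f y)) * ennreal (w y) \<partial>lebesgue)"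
      by auto
    have C1: "weakL1_norm w (T f) \<le> ennreal C1 * Lq_norm q w f" if "f \<in> Lq q w" for f
      unfolding weakL1_norm_def
    proof (rule SUP_least)
      fix l :: real assume "l \<in> {0<..}"
      then have l: "0 < l" by simp
      have "ennreal l * wmeas w {x. norm (T f x) > l} \<le> ennreal l * (ennreal (C1 / l) * Lq_norm q w f)"
        using weak[OF l, of f] that q1 by (intro mult_left_mono) (auto simp: Lq_norm_def)
      also have "\<dots> = ennreal C1 * Lq_norm q w f"
        using l \<open>0 < C1\<close> by (simp add: mult.assoc[symmetric] flip: ennreal_mult)
      finally show "ennreal l * wmeas w {x. norm (T f x) > l} \<le> ennreal C1 * Lq_norm q w f" .
    qed
    assume \<alpha>p: "1 \<le> \<alpha>" "\<alpha> < p"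
    then have \<alpha>: "ennreal q \<le> \<alpha>" using q1 by simp
    have "\<exists>C>0. \<forall>f\<in>amalgam q w p \<alpha>. T f \<in> borel_measurable lebesgue \<and>
        amalgam_norm_of (weakL1_norm w) q w p \<alpha> (T f) \<le> ennreal C * amalgam_norm q w p \<alpha> f"
    proof (rule main[of 2 "weakL1_norm w" C1])
      fix g h :: "'a \<Rightarrow> 'b" and y :: 'a and r :: real and M
      assume "h \<in> borel_measurable lebesgue"
        and "AE x in lebesgue. x \<in> ball y r \<longrightarrow> ennreal (norm (g x)) \<le> ennreal (norm (h x)) + M"
      then show "weakL1_norm w (restr g (ball y r))
          \<le> ennreal 2 * (weakL1_norm w h + epowr (wmeas w (ball y r)) (1 / q) * M)"
        using weakL1_norm_restr_le[OF wt, of h "ball y r" g M] q1 by simp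
    qed (auto intro!: borel_measurable_weakL1_norm_restr_ball wt \<open>0 < C1\<close> C1 \<alpha> \<alpha>p(2))
    then show "bounded_between T (amalgam 1 w p \<alpha>) (amalgam_norm 1 w p \<alpha>)
        (weak_amalgam w p \<alpha>) (weak_amalgam_norm w p \<alpha>)"
      unfolding bounded_between_def weak_amalgam_norm_def q1[symmetric]
      by (auto simp: amalgam_def weak_amalgam_def weak_amalgam_norm_def q1 ennreal_mult_less_top intro: le_less_trans)
  }
qed

end
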